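(* Let $1<c<\frac{6}{5}$ and let \[ S_c = \{ \lfloor n^c \rfloor : n \in \mathbb{N}\}. \] Then for every $\varepsilon>0$ and all $N\in\mathbb{N}$, \[ \gamma_{S_c}(N) \ll_{c,\varepsilon} N^{-\left(\frac{6}{5c}-1\right)+\varepsilon}. \] Thus if $A \subseteq \{1, \dotsc, N\}$ lacks configurations of the form $\{x,x+\lfloor n^c \rfloor\}$ with $n \neq 0$ (that is, there are no integer $x$ and $n\in\mathbb{N}$ such that both $x$ and $x+\lfloor n^c\rfloor$ lie in $A$), then \[ |A| \ll_{c} N^{1-\left(\frac{6}{5c}-1\right)}. \]
   Context: $\mathbb{N}=\{1,2,3,\dotsc\}$; $\lfloor\cdot\rfloor$ is the floor function; $|A|$ is the cardinality of $A$. The notation $X\ll_p Y$ means $|X|\le C\,Y$ for a constant $C>0$ depending only on the parameters $p$ (here, independent of $N$ and $A$). For a set $S$, let $\mathcal{T}_{S\cap\{1,\dotsc,N\}}$ denote the set of real trigonometric polynomials \[ T(\xi)=a_0+\sum_{s\in S\cap\{1,\dotsc,N\}} a_s\cos(2\pi s\xi)\qquad (a_0,a_s\in\mathbb{R}) \] satisfying $T(\xi)\ge 0$ for all $\xi\in\mathbb{R}$ and $T(0)=1$. Define \[ \gamma_S(N)=\inf_{T\in\mathcal{T}_{S\cap\{1,\dotsc,N\}}} a_0, \] where $a_0$ denotes the constant coefficient of $T$. *)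

theory Defs imports Complex_Main begin

definition cos_poly :: "int set \<Rightarrow> (int \<Rightarrow> real) \<Rightarrow> real \<Rightarrow> real" where
  "cos_poly F a \<xi> = a 0 + (\<Sum>s\<in>F. a s * cos (2 * pi * of_int s * \<xi>))"

text \<open>
  The set of all \<open>T\<close> with spectrum in \<open>F\<close>, each given by its coefficient function \<open>a\<close>, for
  finite sets \<open>F\<close> of positive integers: as \<open>0 \<notin> F\<close>, the value \<open>a 0\<close> is the constant
  coefficient and nothing else. Values of \<open>a\<close> outside \<open>insert 0 F\<close> are irrelevant.
\<close>
definition nonneg_cos_polys :: "int set \<Rightarrow> (int \<Rightarrow> real) set" where
  "nonneg_cos_polys F = {a. (\<forall>\<xi>. cos_poly F a \<xi> \<ge> 0) \<and> cos_poly F a 0 = 1}"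

text \<open>
  The infimum is over a nonempty set (\<open>T = 1\<close>) bounded below by 0 (\<open>a 0\<close> is the mean value
  of \<open>T\<close>), so the real-valued \<open>INF\<close> is the genuine infimum.
\<close>
definition gamma_S :: "int set \<Rightarrow> nat \<Rightarrow> real" where
  "gamma_S S N = (INF a\<in>nonneg_cos_polys (S \<inter> {1..int N}). a 0)"

definition floor_powers :: "real \<Rightarrow> int set" where
  "floor_powers c = {\<lfloor>real n powr c\<rfloor> | n::nat. n \<ge> 1}"

end

theory Submission imports Defs "HOL-Analysis.Analysis" begin

text \<open>
  Write \<open>e t = exp (2 \<pi> i t)\<close>, \<open>\<eta> = 6/5 - c\<close>, and let \<open>P\<close> be the largest integer with \<open>P\<^sup>c \<le> N\<close>.
  The idea is to exhibit one cosine polynomial. If weights \<open>p n\<close> are such that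
  \<open>F \<xi> = (\<Sum>n<P. p n * cos (2 \<pi> \<lfloor>n\<^sup>c\<rfloor> \<xi>))\<close> satisfies \<open>F \<ge> - E\<close> everywhere, then
  \<open>(F + E) / (F 0 + E)\<close> is nonnegative with value 1 at 0, and its constant coefficient is about
  \<open>E / F 0\<close> (\<open>gamma_S_le\<close>). The weights below give \<open>F 0\<close> of size \<open>P\<^sup>c\<close> and \<open>E\<close> of size
  \<open>P\<close> to the power \<open>c - \<eta>\<close>, hence \<open>gamma_S\<close> is at most of size \<open>P\<close> to the power \<open>- \<eta>\<close>,
  that is \<open>N\<close> to the power \<open>- \<eta> / c = - (6 / (5 c) - 1)\<close>.

  The weights are \<open>p n = v n * W n\<close>. The factor
  \<open>v n = ((n + 1)\<^sup>c - n\<^sup>c) * (1 - n\<^sup>c / P\<^sup>c)\<close> turns \<open>\<Sum>n<P. v n * e (\<xi> n\<^sup>c)\<close> into a Riemann sum of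
  the integral of \<open>(1 - y / Y) * e (\<xi> y)\<close> over \<open>0 \<le> y \<le> Y = P\<^sup>c\<close>, whose real part is
  \<open>(1 - cos (2 \<pi> \<xi> Y)) / (Y (2 \<pi> \<xi>)\<^sup>2) \<ge> 0\<close>; this controls small \<open>\<xi>\<close>
  (\<open>Re_expsum_small_frequency\<close>). The factor \<open>W n\<close> is the value at \<open>n\<^sup>c - 1/2\<close> of the Fejer kernel of
  order \<open>H\<close>, with \<open>H\<close> about \<open>P\<close> to the power \<open>\<eta>\<close>. It favours those \<open>n\<close> for which
  \<open>u = n\<^sup>c - 1/2 - \<lfloor>n\<^sup>c\<rfloor>\<close> is small, so that in \<open>e (\<xi> \<lfloor>n\<^sup>c\<rfloor>) = e (\<xi> (n\<^sup>c - 1/2)) * e (- \<xi> u)\<close> the second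
  factor may be replaced by the linear interpolation \<open>(1 - \<xi>) + \<xi> * e (- u)\<close>. The error is
  \<open>O(u\<^sup>2)\<close>, and the Fejer kernel times \<open>u\<^sup>2\<close> is \<open>O(1 / H)\<close>. As the kernel is a trigonometric
  polynomial, what is left are the sums \<open>\<Sum>n<P. v n * e (\<alpha> n\<^sup>c)\<close> without floors, at frequencies
  \<open>\<alpha>\<close> in \<open>\<xi> + \<int>\<close> with \<open>\<bar>\<alpha>\<bar> \<le> H\<close> (\<open>fejer_weight_sum_lower\<close>).

  All these sums, except the one at \<open>\<alpha> = \<xi>\<close> when \<open>\<xi>\<close> is small, are estimated by van der Corput's
  second derivative test, in a discrete form for sequences whose differences increase by at least
  \<open>\<mu>\<close> at each step (\<open>second_difference_test\<close>). Its output for the frequencies with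
  \<open>1/2 \<le> \<bar>\<alpha>\<bar> \<le> H\<close> is \<open>P\<close> to the power \<open>3 c / 2 - 1\<close> times \<open>H\<close> to the power \<open>1/2\<close>. Summed over the
  frequencies this has the size \<open>P\<close> to the power \<open>4/5\<close>, which does not exceed the Fejer error
  \<open>P\<^sup>c / H\<close> because \<open>c > 1\<close>. No logarithms arise, so the bound holds without any loss of
  \<open>N\<close> to the power \<open>\<epsilon>\<close>.

  For the second claim, a discrete Fourier transform modulo \<open>2 N\<close> shows that every admissible
  polynomial has constant coefficient at least \<open>card A / (2 N)\<close> (\<open>card_le_constant_coefficient\<close>).
\<close>

section \<open>The second difference test for exponential sums\<close>

definition e :: "real \<Rightarrow> complex" where
  "e t = cis (2 * pi * t)"

lemma norm_e [simp]: "norm (e t) = 1" by (simp add: e_def)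
lemma e_0 [simp]: "e 0 = 1" by (simp add: e_def)
lemma e_add: "e (s + t) = e s * e t" by (simp add: e_def cis_mult distrib_left)
lemma e_of_int [simp]: "e (of_int k) = 1"
  by (simp add: e_def cis.ctr complex_eq_iff)
lemma e_minus: "e (- t) = cnj (e t)" by (simp add: e_def cis_cnj)
lemma Re_e: "Re (e t) = cos (2 * pi * t)" by (simp add: e_def)

lemma summation_by_parts_bound:
  fixes g x :: "nat \<Rightarrow> complex"
  assumes "a < b" and x: "\<And>n. norm (x n) \<le> 1"
  shows "norm (\<Sum>n=a..<b. (x n - x (Suc n)) * g n)
           \<le> norm (g a) + norm (g (b - 1)) + (\<Sum>n=a..<b - 1. norm (g (Suc n) - g n))"
proof -
  obtain d where b: "b = Suc (a + d)"
    using assms(1) less_iff_Suc_add by blast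
  have eq: "(\<Sum>n=a..<Suc (a + d). (x n - x (Suc n)) * g n)
      = x a * g a - x (Suc (a + d)) * g (a + d) + (\<Sum>n=a..<a + d. x (Suc n) * (g (Suc n) - g n))"
    by (induction d) (auto simp: algebra_simps)
  have "norm (\<Sum>n=a..<a + d. x (Suc n) * (g (Suc n) - g n)) \<le> (\<Sum>n=a..<a + d. norm (g (Suc n) - g n))"
    by (intro sum_norm_le) (use x in \<open>auto simp: norm_mult mult_left_le_one_le\<close>)
  moreover have "norm (x a * g a) \<le> norm (g a)" "norm (x (Suc (a + d)) * g (a + d)) \<le> norm (g (a + d))"
    using x by (auto simp: norm_mult mult_left_le_one_le)
  ultimately show ?thesis
    unfolding b eq using norm_triangle_ineq4[of "x a * g a" "x (Suc (a + d)) * g (a + d)"]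
    by (intro norm_triangle_le) auto
qed

text \<open>
  The second factor is the inverse of \<open>1 - e t\<close>. Its real part is constant, so along a sequence
  of \<open>t\<close> only the monotone function \<open>cot\<close> contributes to its variation.
\<close>
lemma geometric_factor:
  assumes "sin (pi * t) \<noteq> 0"
  shows "(1 - e t) * Complex (1 / 2) (cot (pi * t) / 2) = 1"
proof -
  define s where "s = sin (pi * t)"
  define k where "k = cos (pi * t)"
  have 1: "cos (2 * pi * t) = k\<^sup>2 - s\<^sup>2" "sin (2 * pi * t) = 2 * s * k"
    using cos_double[of "pi * t"] sin_double[of "pi * t"] by (simp_all add: s_def k_def mult_ac)
  have 2: "k\<^sup>2 = 1 - s\<^sup>2" by (simp add: s_def k_def cos_squared_eq)
  have s: "s \<noteq> 0" using assms s_def by simp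
  have e: "e t = Complex (1 - 2 * s * s) (2 * s * k)"
    using 1 2 by (simp add: e_def complex_eq_iff power2_eq_square)
  have c: "cot (pi * t) = k / s" by (simp add: cot_def s_def k_def)
  have k: "k * k = 1 - s * s" using 2 by (simp add: power2_eq_square)
  show ?thesis
    unfolding e c complex_eq_iff using s k
    by (simp add: field_simps)
qed

lemma cot_decreasing:
  assumes "0 < x" "x \<le> y" "y < pi"
  shows "cot y \<le> cot x"
proof -
  have "0 \<le> sin (y - x)" using assms by (intro sin_ge_zero) auto
  then have "sin x * cos y \<le> sin y * cos x" by (simp add: sin_diff mult_ac)
  moreover have "0 < sin x" "0 < sin y" using assms by (auto intro!: sin_gt_zero)
  ultimately show ?thesis by (simp add: cot_def divide_simps mult_ac)
qed

text \<open>
  Concavity of the sine: its graph lies above the chord from \<open>0\<close> to \<open>\<pi> / 2\<close>.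
\<close>
lemma sin_pi_ge:
  assumes "0 \<le> u" "u \<le> 1 / 2"
  shows "2 * u \<le> sin (pi * u)"
proof (cases "u = 0")
  case False
  have "concave_on {0..pi} sin"
    by (rule f''_le0_imp_concave[where f' = cos and f'' = "\<lambda>x. - sin x"])
       (auto intro!: derivative_eq_intros sin_ge_zero)
  from concave_onD[OF this, of "2*u" 0 "pi/2"] show ?thesis
    using assms by (simp add: algebra_simps)
qed auto

lemma sin_pi_ge_away_from_int:
  assumes "0 < \<theta>" "\<theta> \<le> t" "t \<le> 1 - \<theta>"
  shows "2 * \<theta> \<le> sin (pi * t)"
proof (cases "t \<le> 1 / 2")
  case True
  then show ?thesis using sin_pi_ge[of t] assms by simp
next
  case False
  have "sin (pi * t) = sin (pi * (1 - t))" by (simp add: algebra_simps)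
  then show ?thesis using sin_pi_ge[of "1 - t"] assms False by simp
qed

lemma cot_bound:
  assumes "0 < \<theta>" "\<theta> \<le> t" "t \<le> 1 - \<theta>"
  shows "\<bar>cot (pi * t)\<bar> \<le> 1 / (2 * \<theta>)"
proof -
  have s: "2 * \<theta> \<le> sin (pi * t)" using sin_pi_ge_away_from_int assms .
  have "\<bar>cot (pi * t)\<bar> = \<bar>cos (pi * t)\<bar> / sin (pi * t)"
    using s assms(1) by (simp add: cot_def abs_divide)
  also have "\<dots> \<le> 1 / (2 * \<theta>)"
    using s assms(1) by (intro frac_le) auto
  finally show ?thesis .
qed

text \<open>
  While the differences stay away from the integers, each term is
  \<open>(e (f n) - e (f (n + 1))) * g n\<close> with \<open>g n = 1 / (1 - e (\<delta> n))\<close>, the inverse provided by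
  \<open>geometric_factor\<close>. Summation by parts bounds the sum by the size and the variation of \<open>g\<close>;
  as \<open>\<delta>\<close> is monotone, the variation telescopes to a difference of two cotangents.
\<close>
lemma kusmin_landau:
  fixes f \<delta> :: "nat \<Rightarrow> real" and k :: int and \<theta> :: real
  defines "\<delta> \<equiv> (\<lambda>n. f (Suc n) - f n)"
  assumes \<theta>: "0 < \<theta>" "\<theta> \<le> 1 / 2"
    and range: "\<And>n. a \<le> n \<Longrightarrow> n < b \<Longrightarrow> k + \<theta> \<le> \<delta> n \<and> \<delta> n \<le> k + 1 - \<theta>"
    and mono: "\<And>n. a \<le> n \<Longrightarrow> Suc n < b \<Longrightarrow> \<delta> n \<le> \<delta> (Suc n)"
  shows "norm (\<Sum>n=a..<b. e (f n)) \<le> 2 / \<theta>"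
proof (cases "a < b")
  case True
  define t where "t = (\<lambda>n. \<delta> n - k)"
  define g where "g = (\<lambda>n. Complex (1 / 2) (cot (pi * t n) / 2))"
  have t: "\<theta> \<le> t n" "t n \<le> 1 - \<theta>" if "a \<le> n" "n < b" for n
    using range[OF that] by (auto simp: t_def)
  have e_t: "e (t n) = e (\<delta> n)" for n
    using e_add[of "t n" "of_int k"] by (simp add: t_def)
  have step: "(e (f n) - e (f (Suc n))) * g n = e (f n)" if "a \<le> n" "n < b" for n
  proof -
    have "e (f (Suc n)) = e (f n) * e (t n)"
      unfolding e_t using e_add[of "f n" "\<delta> n"] by (simp add: \<delta>_def)
    moreover have "sin (pi * t n) \<noteq> 0"
      using sin_pi_ge_away_from_int[OF \<theta>(1) t[OF that]] \<theta> by auto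
    moreover have "(e (f n) - e (f n) * e (t n)) * g n = e (f n) * ((1 - e (t n)) * g n)"
      by (simp add: algebra_simps)
    ultimately show ?thesis using geometric_factor[of "t n"] by (simp add: g_def)
  qed
  have g: "norm (g n) \<le> 1 / 2 + 1 / (4 * \<theta>)" if "a \<le> n" "n < b" for n
    using cmod_le[of "g n"] cot_bound[OF \<theta>(1) t[OF that]] by (simp add: g_def)
  have diff: "norm (g (Suc n) - g n) = cot (pi * t n) / 2 - cot (pi * t (Suc n)) / 2"
    if "a \<le> n" "n < b - 1" for n
  proof -
    have "g (Suc n) - g n = Complex 0 (cot (pi * t (Suc n)) / 2 - cot (pi * t n) / 2)"
      by (simp add: g_def complex_eq_iff)
    moreover have "cot (pi * t (Suc n)) \<le> cot (pi * t n)"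
    proof (rule cot_decreasing)
      have "0 < t n" using t[of n] that \<theta> by linarith
      then show "0 < pi * t n" by simp
      show "pi * t n \<le> pi * t (Suc n)" using mono[of n] that by (simp add: t_def)
      have "t (Suc n) < 1" using t[of "Suc n"] that \<theta> by linarith
      then show "pi * t (Suc n) < pi" by simp
    qed
    ultimately show ?thesis by (simp add: cmod_def)
  qed
  have "(\<Sum>n=a..<b - 1. norm (g (Suc n) - g n))
      = (\<Sum>n=a..<b - 1. cot (pi * t n) / 2 - cot (pi * t (Suc n)) / 2)"
    by (intro sum.cong) (use diff in auto)
  also have "\<dots> = cot (pi * t a) / 2 - cot (pi * t (b - 1)) / 2"
    using sum_Suc_diff'[of a "b - 1" "\<lambda>n. - (cot (pi * t n) / 2)"] True by simp
  also have "\<dots> \<le> 1 / (2 * \<theta>)"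
  proof -
    have "\<bar>cot (pi * t a)\<bar> \<le> 1 / (2 * \<theta>)" "\<bar>cot (pi * t (b - 1))\<bar> \<le> 1 / (2 * \<theta>)"
      using cot_bound[OF \<theta>(1) t[of a]] cot_bound[OF \<theta>(1) t[of "b - 1"]] True by auto
    then show ?thesis by linarith
  qed
  finally have var: "(\<Sum>n=a..<b - 1. norm (g (Suc n) - g n)) \<le> 1 / (2 * \<theta>)" .
  have "(\<Sum>n=a..<b. e (f n)) = (\<Sum>n=a..<b. (e (f n) - e (f (Suc n))) * g n)"
    by (intro sum.cong) (use step in auto)
  also have "norm \<dots> \<le> norm (g a) + norm (g (b - 1)) + (\<Sum>n=a..<b - 1. norm (g (Suc n) - g n))"
    using True by (intro summation_by_parts_bound) auto
  also have "\<dots> \<le> (1 / 2 + 1 / (4 * \<theta>)) + (1 / 2 + 1 / (4 * \<theta>)) + 1 / (2 * \<theta>)"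
    using g[of a] g[of "b - 1"] var True by (intro add_mono) auto
  also have "\<dots> \<le> 2 / \<theta>"
    using \<theta> by (simp add: field_simps)
  finally show ?thesis .
qed (use \<theta> in auto)

text \<open>
  The differences \<open>\<delta>\<close> grow by at least \<open>\<mu>\<close> per step. Cut the range where \<open>\<delta>\<close> passes an integer
  \<open>k\<close>; there are at most \<open>\<delta> L - \<delta> 0 + 2\<close> pieces. On each piece at most \<open>\<theta> / \<mu> + 1\<close> indices lie
  within \<open>\<theta>\<close> of either end, and the others form one sum of size \<open>2 / \<theta>\<close> by \<open>kusmin_landau\<close>.
  The choice \<open>\<theta> = sqrt \<mu> / 2\<close> balances the two. Since the increments of \<open>\<delta>\<close> may be
  large, the test applies to multiples of \<open>n\<^sup>c\<close> from \<open>n = 0\<close> on, without a dyadic decomposition.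
\<close>
lemma second_difference_test:
  fixes f \<delta> :: "nat \<Rightarrow> real"
  defines "\<delta> \<equiv> (\<lambda>n. f (Suc n) - f n)"
  assumes \<mu>: "0 < \<mu>" "\<mu> \<le> 1"
    and conv: "\<And>n. n < L \<Longrightarrow> \<delta> n + \<mu> \<le> \<delta> (Suc n)"
  shows "norm (\<Sum>n<L. e (f n)) \<le> 7 * (\<delta> L - \<delta> 0 + 2) / sqrt \<mu>"
proof -
  define \<theta> where "\<theta> = sqrt \<mu> / 2"
  have \<theta>: "0 < \<theta>" "\<theta> \<le> 1 / 2" using \<mu> by (auto simp: \<theta>_def)
  have inc: "\<delta> m + real d * \<mu> \<le> \<delta> (m + d)" if "m + d \<le> L" for m d
    using that
  proof (induction d)
    case (Suc d)
    then show ?case using conv[of "m + d"] by (simp add: algebra_simps)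
  qed simp
  have incr: "\<delta> m + (real n - real m) * \<mu> \<le> \<delta> n" if "m \<le> n" "n \<le> L" for m n
    using inc[of m "n - m"] that by (simp add: of_nat_diff)
  have mono: "\<delta> m \<le> \<delta> n" if "m \<le> n" "n \<le> L" for m n
    using incr[OF that] \<mu> that by (smt (verit) mult_nonneg_nonneg of_nat_mono)
  \<comment> \<open>The first index at which \<open>\<delta>\<close> reaches \<open>p\<close>, or \<open>L\<close> if there is none; blocks are intervals \<open>a p..<a q\<close>.\<close>
  define a where "a = (\<lambda>p. LEAST n. L \<le> n \<or> p \<le> \<delta> n)"
  have a_iff: "n < a p \<longleftrightarrow> n < L \<and> \<delta> n < p" for n p
  proof
    assume "n < a p"
    then show "n < L \<and> \<delta> n < p" using not_less_Least[of n "\<lambda>n. L \<le> n \<or> p \<le> \<delta> n"]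
      by (auto simp: a_def)
  next
    assume n: "n < L \<and> \<delta> n < p"
    have "L \<le> a p \<or> p \<le> \<delta> (a p)" unfolding a_def by (rule LeastI[of _ L]) simp
    then show "n < a p" using n mono[of "a p" n] by (cases "n < a p") auto
  qed
  have a_mono: "a p \<le> a q" if "p \<le> q" for p q
    using a_iff[of "a q" p] a_iff[of "a q" q] that by (cases "a q < a p") auto
  have few: "norm (\<Sum>n=a p..<a q. e (f n)) \<le> (q - p) / \<mu> + 1" if "p \<le> q" for p q
  proof (cases "a p < a q")
    case True
    have 1: "p \<le> \<delta> (a p)" using True a_iff[of "a p" p] a_iff[of "a p" q] by auto
    have 2: "a q - 1 < L" "\<delta> (a q - 1) < q" using True a_iff[of "a q - 1" q] by auto
    have "(real (a q - 1) - real (a p)) * \<mu> \<le> q - p"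
      using incr[of "a p" "a q - 1"] 1 2 True by linarith
    then have "real (a q) - real (a p) \<le> (q - p) / \<mu> + 1"
      using \<mu> True by (simp add: field_simps of_nat_diff)
    moreover have "norm (\<Sum>n=a p..<a q. e (f n)) \<le> real (a q) - real (a p)"
      using True by (intro order_trans[OF norm_sum]) (simp add: of_nat_diff)
    ultimately show ?thesis by linarith
  qed (use that \<mu> in auto)
  have block: "norm (\<Sum>n=a (of_int k)..<a (of_int k + 1). e (f n)) \<le> 7 / sqrt \<mu>" for k :: int
  proof -
    let ?k = "of_int k :: real"
    have ord: "a ?k \<le> a (?k + \<theta>)" "a (?k + \<theta>) \<le> a (?k + 1 - \<theta>)" "a (?k + 1 - \<theta>) \<le> a (?k + 1)"
      using \<theta> by (auto intro!: a_mono)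
    have split: "(\<Sum>n=a ?k..<a (?k + 1). e (f n)) = (\<Sum>n=a ?k..<a (?k + \<theta>). e (f n))
        + (\<Sum>n=a (?k + \<theta>)..<a (?k + 1 - \<theta>). e (f n)) + (\<Sum>n=a (?k + 1 - \<theta>)..<a (?k + 1). e (f n))"
      using ord by (simp add: sum.atLeastLessThan_concat)
    have 1: "norm (\<Sum>n=a ?k..<a (?k + \<theta>). e (f n)) \<le> \<theta> / \<mu> + 1"
      using few[of ?k "?k + \<theta>"] \<theta> by simp
    have 3: "norm (\<Sum>n=a (?k + 1 - \<theta>)..<a (?k + 1). e (f n)) \<le> \<theta> / \<mu> + 1"
      using few[of "?k + 1 - \<theta>" "?k + 1"] \<theta> by simp
    have 2: "norm (\<Sum>n=a (?k + \<theta>)..<a (?k + 1 - \<theta>). e (f n)) \<le> 2 / \<theta>"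
    proof (rule kusmin_landau[OF \<theta>, where k = k], goal_cases)
      case (1 n)
      then show ?case using a_iff[of n "?k + \<theta>"] a_iff[of n "?k + 1 - \<theta>"] by (auto simp: \<delta>_def)
    next
      case (2 n)
      then show ?case using a_iff[of "Suc n" "?k + 1 - \<theta>"] mono[of n "Suc n"] by (auto simp: \<delta>_def)
    qed
    have s: "sqrt \<mu> \<le> 1" "0 < sqrt \<mu>" using \<mu> by auto
    have "\<theta> / \<mu> = 1 / (2 * sqrt \<mu>)"
    proof -
      have "x / 2 / (x * x) = 1 / (2 * x)" if "0 < x" for x :: real using that by simp
      from this[OF s(2)] show ?thesis using \<mu> by (simp add: \<theta>_def)
    qed
    moreover have "2 / \<theta> = 4 / sqrt \<mu>" by (simp add: \<theta>_def)
    moreover have "1 \<le> 1 / sqrt \<mu>" using s by simp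
    ultimately have "(\<theta> / \<mu> + 1) + 2 / \<theta> + (\<theta> / \<mu> + 1) \<le> 7 / sqrt \<mu>"
      by (simp add: field_simps)
    moreover have "norm (x + y + z) \<le> norm x + norm y + norm z" for x y z :: complex
      by (intro norm_triangle_le add_right_mono norm_triangle_ineq)
    ultimately show ?thesis unfolding split using 1 2 3 by (smt (verit))
  qed
  define k0 where "k0 = \<lfloor>\<delta> 0\<rfloor>"
  have start: "a (of_int k0) = 0"
  proof (rule ccontr)
    assume "a (of_int k0) \<noteq> 0"
    then have "0 < L \<and> \<delta> 0 < of_int k0" using a_iff[of 0 "of_int k0"] by simp
    then show False by (simp add: k0_def) linarith
  qed
  have upto: "norm (\<Sum>n<a (of_int k0 + real j). e (f n)) \<le> j * (7 / sqrt \<mu>)" for j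
  proof (induction j)
    case (Suc j)
    have "(\<Sum>n<a (of_int k0 + real (Suc j)). e (f n)) = (\<Sum>n<a (of_int k0 + real j). e (f n))
        + (\<Sum>n=a (of_int (k0 + int j))..<a (of_int (k0 + int j) + 1). e (f n))"
      using a_mono[of "of_int k0 + real j" "of_int k0 + real (Suc j)"]
      by (simp add: lessThan_atLeast0 sum.atLeastLessThan_concat add_ac)
    also have "norm \<dots> \<le> j * (7 / sqrt \<mu>) + 7 / sqrt \<mu>"
      by (intro norm_triangle_mono Suc block)
    finally show ?case by (simp add: algebra_simps add_divide_distrib)
  qed (use start in simp)
  define J where "J = nat (\<lfloor>\<delta> L\<rfloor> + 1 - k0)"
  have "k0 \<le> \<lfloor>\<delta> L\<rfloor>" using mono[of 0 L] by (auto simp: k0_def intro!: floor_mono)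
  then have J: "real J = of_int \<lfloor>\<delta> L\<rfloor> + 1 - of_int k0" by (simp add: J_def)
  have finish: "a (of_int k0 + real J) = L"
  proof -
    have "n < a (of_int k0 + real J) \<longleftrightarrow> n < L" for n
    proof -
      have "\<delta> n < of_int k0 + real J" if "n < L"
        using mono[of n L] that unfolding J by (simp, linarith)
      then show ?thesis using a_iff by blast
    qed
    from this[of L] this[of "a (of_int k0 + real J)"] show ?thesis by linarith
  qed
  have "real J \<le> \<delta> L - \<delta> 0 + 2" unfolding J k0_def by linarith
  then have "real J * (7 / sqrt \<mu>) \<le> (\<delta> L - \<delta> 0 + 2) * (7 / sqrt \<mu>)"
    using \<mu> by (intro mult_right_mono) auto
  then show ?thesis using upto[of J] unfolding finish by (simp add: mult_ac)
qed

section \<open>Weighted exponential sums over powers\<close>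

lemma norm_weighted_sum_le:
  fixes w :: "nat \<Rightarrow> real" and z :: "nat \<Rightarrow> complex"
  assumes B: "\<And>k. k \<le> L \<Longrightarrow> norm (\<Sum>n<k. z n) \<le> B"
  shows "norm (\<Sum>n<L. w n * z n) \<le> B * (\<bar>w L\<bar> + (\<Sum>n<L. \<bar>w (Suc n) - w n\<bar>))"
proof -
  have "(\<Sum>n<L. w n * z n) = w L * (\<Sum>n<L. z n) - (\<Sum>n<L. (w (Suc n) - w n) * (\<Sum>m<Suc n. z m))"
    by (induction L) (auto simp: algebra_simps)
  also have "norm \<dots> \<le> norm (w L * (\<Sum>n<L. z n)) + norm (\<Sum>n<L. (w (Suc n) - w n) * (\<Sum>m<Suc n. z m))"
    by (rule norm_triangle_ineq4)
  also have "norm (w L * (\<Sum>n<L. z n)) \<le> \<bar>w L\<bar> * B"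
    using B[of L] by (simp add: norm_mult mult_left_mono)
  also have "norm (\<Sum>n<L. (w (Suc n) - w n) * (\<Sum>m<Suc n. z m)) \<le> (\<Sum>n<L. \<bar>w (Suc n) - w n\<bar> * B)"
  proof (intro sum_norm_le)
    fix n assume "n \<in> {..<L}"
    then have "norm (\<Sum>m<Suc n. z m) \<le> B" by (intro B) auto
    then show "norm ((w (Suc n) - w n) * (\<Sum>m<Suc n. z m)) \<le> \<bar>w (Suc n) - w n\<bar> * B"
      by (simp only: norm_mult norm_of_real mult_left_mono abs_ge_zero)
  qed
  finally show ?thesis by (simp add: sum_distrib_left algebra_simps)
qed

lemma norm_increasing_weights_le:
  fixes w :: "nat \<Rightarrow> real" and z :: "nat \<Rightarrow> complex"
  assumes "\<And>k. k \<le> L \<Longrightarrow> norm (\<Sum>n<k. z n) \<le> B"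
    and "\<And>n. w n \<le> w (Suc n)" "0 \<le> w 0"
  shows "norm (\<Sum>n<L. w n * z n) \<le> 2 * w L * B"
proof -
  have "(\<Sum>n<L. \<bar>w (Suc n) - w n\<bar>) = w L - w 0"
    using assms(2) sum_lessThan_telescope[of w L] by simp
  moreover have "0 \<le> w L" using assms(2,3) lift_Suc_mono_le[of w 0 L] by force
  moreover have "0 \<le> B" using assms(1)[of 0] by simp
  ultimately show ?thesis using norm_weighted_sum_le[of L z B w] assms(1,3)
    by (smt (verit) mult.commute mult_left_mono)
qed

lemma norm_decreasing_weights_le:
  fixes w :: "nat \<Rightarrow> real" and z :: "nat \<Rightarrow> complex"
  assumes "\<And>k. k \<le> L \<Longrightarrow> norm (\<Sum>n<k. z n) \<le> B"
    and "\<And>n. w (Suc n) \<le> w n" "0 \<le> w L"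
  shows "norm (\<Sum>n<L. w n * z n) \<le> w 0 * B"
proof -
  have "(\<Sum>n<L. \<bar>w (Suc n) - w n\<bar>) = w 0 - w L"
    using assms(2) sum_lessThan_telescope'[of w L] by (simp add: abs_minus_commute[of "w (Suc _)"])
  then show ?thesis using norm_weighted_sum_le[of L z B w] assms(1,3)
    by (simp add: mult.commute)
qed

definition gap :: "real \<Rightarrow> real \<Rightarrow> real" where
  "gap c x = (x + 1) powr c - x powr c"

lemma powr_gap_mean_value:
  assumes "0 < r" "0 \<le> x"
  obtains z where "x < z" "z < x + 1" "gap r x = r * z powr (r - 1)"
proof -
  have "\<exists>l z. x < z \<and> z < x + 1 \<and> ((\<lambda>y. y powr r) has_real_derivative l) (at z) \<and>
      (x + 1) powr r - x powr r = (x + 1 - x) * l"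
  proof (intro MVT continuous_on_powr' continuous_intros)
    show "(\<lambda>y. y powr r) differentiable at y" if "x < y" for y
      using that assms has_real_derivative_powr[of y r] by (auto simp: real_differentiable_def)
  qed (use assms in auto)
  then obtain l z where z: "x < z" "z < x + 1" "((\<lambda>y. y powr r) has_real_derivative l) (at z)"
      "gap r x = l" by (auto simp: gap_def)
  moreover have "((\<lambda>y. y powr r) has_real_derivative r * z powr (r - 1)) (at z)"
    using z assms by (intro has_real_derivative_powr) auto
  ultimately show ?thesis using that DERIV_unique by blast
qed

lemma gap_upper:
  assumes "1 < c" "c < 2" "0 \<le> x" "x \<le> real P" "1 \<le> P"
  shows "gap c x \<le> 4 * real P powr (c - 1)"
proof -
  obtain z where z: "x < z" "z < x + 1" "gap c x = c * z powr (c - 1)"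
    using powr_gap_mean_value[of c x] assms by auto
  have "z powr (c - 1) \<le> (2 * real P) powr (c - 1)"
    using z assms by (intro powr_mono2) auto
  also have "\<dots> = 2 powr (c - 1) * real P powr (c - 1)" by (simp add: powr_mult)
  also have "\<dots> \<le> 2 powr 1 * real P powr (c - 1)"
    using assms by (intro mult_right_mono powr_mono) auto
  finally have "c * z powr (c - 1) \<le> 2 * (2 * real P powr (c - 1))"
    using assms by (intro mult_mono) auto
  then show ?thesis using z by simp
qed

text \<open>
  A second difference written through two applications of the mean value theorem: the second
  derivative \<open>c (c - 1) z\<close> to the power \<open>c - 2\<close> decreases, so its value at the far end
  \<open>x + 2\<close> is a lower bound. The singularity at \<open>0\<close> is harmless, as only interior points occur.
\<close>
lemma gap_increment:
  assumes "1 < c" "c < 2" "0 \<le> x"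
  shows "gap c x + c * (c - 1) * (x + 2) powr (c - 2) \<le> gap c (x + 1)"
proof -
  let ?f = "\<lambda>y::real. (y + 1) powr c - y powr c"
  have der: "(?f has_real_derivative c * gap (c - 1) y) (at y)" if "0 < y" for y
    using that assms
    by (auto intro!: derivative_eq_intros simp: gap_def algebra_simps)
  have "\<exists>l y. x < y \<and> y < x + 1 \<and> (?f has_real_derivative l) (at y) \<and>
      ?f (x + 1) - ?f x = (x + 1 - x) * l"
  proof (intro MVT continuous_on_diff continuous_on_powr' continuous_intros)
    show "?f differentiable at y" if "x < y" for y
      using that assms der[of y] by (auto simp: real_differentiable_def)
  qed (use assms in auto)
  then obtain l y where y: "x < y" "y < x + 1" "(?f has_real_derivative l) (at y)"
      "?f (x + 1) - ?f x = l" by auto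
  have l: "l = c * gap (c - 1) y"
    using y assms der[of y] DERIV_unique by force
  obtain z where z: "y < z" "z < y + 1" "gap (c - 1) y = (c - 1) * z powr (c - 2)"
    using powr_gap_mean_value[of "c - 1" y] y assms by auto
  have "(x + 2) powr (c - 2) \<le> z powr (c - 2)"
    using z y assms by (intro powr_mono2') auto
  then have "c * (c - 1) * (x + 2) powr (c - 2) \<le> l"
    unfolding l z using assms by (simp add: mult_left_mono)
  then show ?thesis using y(4) by (simp add: gap_def)
qed

lemma gap_nonneg: "0 \<le> c \<Longrightarrow> 0 \<le> x \<Longrightarrow> 0 \<le> gap c x"
  by (simp add: gap_def powr_mono2)

lemma gap_mono_Suc:
  assumes "1 < c" "c < 2"
  shows "gap c (real n) \<le> gap c (real (Suc n))"
proof -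
  have "0 \<le> c * (c - 1) * (real n + 2) powr (c - 2)" using assms by simp
  then show ?thesis using gap_increment[OF assms, of "real n"] by (simp add: add.commute)
qed

text \<open>
  The second difference test with increments bounded below by \<open>\<mu> = \<kappa> \<alpha> P\<close> to the power
  \<open>c - 2\<close>. Here \<open>\<kappa>\<close> is half of \<open>c (c - 1)\<close> to absorb the passage from \<open>P\<close> to \<open>n + 2 \<le> 2 P\<close>.
\<close>
lemma exponential_sum_bound:
  assumes c: "1 < c" "c < 2" and P: "1 \<le> P" "Q \<le> P"
    and \<alpha>: "0 < \<alpha>" "\<alpha> * real P powr (c - 2) \<le> 1"
  defines "\<kappa> \<equiv> c * (c - 1) / 2"
  shows "norm (\<Sum>n<Q. e (\<alpha> * real n powr c))
           \<le> 28 * (\<alpha> * real P powr (c - 1) + 1) / sqrt (\<kappa> * (\<alpha> * real P powr (c - 2)))"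
proof -
  define \<mu> where "\<mu> = \<kappa> * (\<alpha> * real P powr (c - 2))"
  have "c * (c - 1) \<le> 2 * 1" using c by (intro mult_mono) auto
  then have \<kappa>: "0 < \<kappa>" "\<kappa> \<le> 1" using c by (auto simp: \<kappa>_def)
  have \<mu>: "0 < \<mu>" "\<mu> \<le> 1"
    using \<kappa> \<alpha> P mult_mono[of \<kappa> 1 "\<alpha> * real P powr (c - 2)" 1] by (auto simp: \<mu>_def)
  let ?f = "\<lambda>n. \<alpha> * real n powr c"
  have \<delta>: "?f (Suc n) - ?f n = \<alpha> * gap c n" for n
    by (simp add: gap_def algebra_simps)
  have "norm (\<Sum>n<Q. e (?f n)) \<le> 7 * ((?f (Suc Q) - ?f Q) - (?f (Suc 0) - ?f 0) + 2) / sqrt \<mu>"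
  proof (rule second_difference_test[OF \<mu>])
    fix n assume n: "n < Q"
    have "real P powr (c - 2) / 2 = 2 powr (-1) * real P powr (c - 2)"
      by (simp add: powr_minus)
    also have "\<dots> \<le> 2 powr (c - 2) * real P powr (c - 2)"
      using c by (intro mult_right_mono powr_mono) auto
    also have "\<dots> = (2 * real P) powr (c - 2)" by (simp add: powr_mult)
    also have "\<dots> \<le> (real n + 2) powr (c - 2)"
      using n P c by (intro powr_mono2') auto
    finally have "\<alpha> * (c * (c - 1) * (real P powr (c - 2) / 2)) \<le> \<alpha> * (c * (c - 1) * (real n + 2) powr (c - 2))"
      using c \<alpha> by (intro mult_left_mono) auto
    also have "\<dots> \<le> \<alpha> * (gap c (real (Suc n)) - gap c (real n))"
      using gap_increment[OF c, of "real n"] \<alpha> by (intro mult_left_mono) (auto simp: add.commute)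
    finally show "(?f (Suc n) - ?f n) + \<mu> \<le> ?f (Suc (Suc n)) - ?f (Suc n)"
      unfolding \<delta> by (simp add: \<mu>_def \<kappa>_def algebra_simps)
  qed
  also have "\<dots> \<le> 28 * (\<alpha> * real P powr (c - 1) + 1) / sqrt \<mu>"
  proof (intro divide_right_mono)
    have "\<alpha> * gap c Q \<le> \<alpha> * (4 * real P powr (c - 1))"
      using gap_upper[OF c, of "real Q" P] P \<alpha> by (intro mult_left_mono) auto
    moreover have "0 \<le> \<alpha> * gap c 0" using \<alpha> by (simp add: gap_def)
    ultimately show "7 * ((?f (Suc Q) - ?f Q) - (?f (Suc 0) - ?f 0) + 2)
        \<le> 28 * (\<alpha> * real P powr (c - 1) + 1)" unfolding \<delta> by simp
  qed (use \<mu> in auto)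
  finally show ?thesis unfolding \<mu>_def .
qed

text \<open>
  The triangle of height 1 on \<open>0 \<le> y \<le> P\<^sup>c\<close>, sampled at \<open>y = n\<^sup>c\<close> and multiplied by the step
  to the next sample point.
\<close>
definition weight :: "real \<Rightarrow> nat \<Rightarrow> nat \<Rightarrow> real" where
  "weight c P n = (1 - real n powr c / real P powr c) * gap c n"

definition expsum :: "real \<Rightarrow> nat \<Rightarrow> real \<Rightarrow> complex" where
  "expsum c P \<alpha> = (\<Sum>n<P. weight c P n * e (\<alpha> * real n powr c))"

lemma weight_bounds:
  assumes "1 < c" "n < P"
  shows "0 \<le> weight c P n" "weight c P n \<le> gap c n"
proof -
  have "real n powr c \<le> real P powr c" using assms by (intro powr_mono2) auto
  moreover have "0 < real P powr c" using assms by auto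
  ultimately have "0 \<le> 1 - real n powr c / real P powr c" "1 - real n powr c / real P powr c \<le> 1"
    by (auto simp: field_simps)
  moreover have "0 \<le> gap c n" using assms by (intro gap_nonneg) auto
  ultimately show "0 \<le> weight c P n" "weight c P n \<le> gap c n"
    unfolding weight_def by (auto intro: mult_left_le_one_le)
qed

lemma sum_gap: "0 < c \<Longrightarrow> (\<Sum>n<P. gap c (real n)) = real P powr c"
  by (induction P) (auto simp: gap_def add.commute)

lemma sum_weight_le:
  assumes "1 < c"
  shows "(\<Sum>n<P. weight c P n) \<le> real P powr c"
proof -
  have "(\<Sum>n<P. weight c P n) \<le> (\<Sum>n<P. gap c (real n))"
    using assms by (intro sum_mono weight_bounds) auto
  then show ?thesis using sum_gap[of c P] assms by simp
qed

lemma norm_expsum_le: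
  assumes "1 < c"
  shows "norm (expsum c P \<alpha>) \<le> real P powr c"
proof -
  have "norm (expsum c P \<alpha>) \<le> (\<Sum>n<P. weight c P n)"
    unfolding expsum_def using weight_bounds[OF assms]
    by (intro sum_norm_le) (auto simp: norm_mult)
  then show ?thesis using sum_weight_le[OF assms] by (rule order_trans)
qed

lemma expsum_minus: "expsum c P (- \<alpha>) = cnj (expsum c P \<alpha>)"
  by (simp add: expsum_def e_minus)

text \<open>
  The two monotone factors of the weight are removed one after the other by summation by parts:
  first the increasing gaps, then the decreasing triangle, which starts at 1 and ends at 0.
\<close>
lemma expsum_bound:
  assumes c: "1 < c" "c < 2" and P: "1 \<le> P"
    and \<alpha>: "\<alpha> \<noteq> 0" "\<bar>\<alpha>\<bar> * real P powr (c - 2) \<le> 1"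
  defines "\<kappa> \<equiv> c * (c - 1) / 2"
  shows "norm (expsum c P \<alpha>)
      \<le> 224 * real P powr (c - 1) * (\<bar>\<alpha>\<bar> * real P powr (c - 1) + 1)
            / sqrt (\<kappa> * (\<bar>\<alpha>\<bar> * real P powr (c - 2)))"
proof -
  define B where "B = 28 * (\<bar>\<alpha>\<bar> * real P powr (c - 1) + 1) / sqrt (\<kappa> * (\<bar>\<alpha>\<bar> * real P powr (c - 2)))"
  have B: "0 \<le> B" using c by (simp add: B_def \<kappa>_def)
  have U: "norm (\<Sum>n<k. e (\<bar>\<alpha>\<bar> * real n powr c)) \<le> B" if "k \<le> P" for k
    unfolding B_def \<kappa>_def using exponential_sum_bound[OF c P that, of "\<bar>\<alpha>\<bar>"] \<alpha> by simp
  have V: "norm (\<Sum>n<k. gap c (real n) * e (\<bar>\<alpha>\<bar> * real n powr c)) \<le> 8 * real P powr (c - 1) * B"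
    if k: "k \<le> P" for k
  proof -
    have "norm (\<Sum>n<k. gap c (real n) * e (\<bar>\<alpha>\<bar> * real n powr c)) \<le> 2 * gap c (real k) * B"
      using U k gap_mono_Suc[OF c] by (intro norm_increasing_weights_le) (auto simp: gap_def)
    also have "\<dots> \<le> 2 * (4 * real P powr (c - 1)) * B"
      using gap_upper[OF c, of "real k" P] k P B by (intro mult_right_mono mult_left_mono) auto
    finally show ?thesis by simp
  qed
  have "norm (\<Sum>n<P. (1 - real n powr c / real P powr c) * (gap c (real n) * e (\<bar>\<alpha>\<bar> * real n powr c)))
      \<le> (1 - real 0 powr c / real P powr c) * (8 * real P powr (c - 1) * B)"
  proof (intro norm_decreasing_weights_le V)
    show "1 - real (Suc n) powr c / real P powr c \<le> 1 - real n powr c / real P powr c" for n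
      using c by (auto intro!: divide_right_mono powr_mono2)
  qed (use P in auto)
  then have "norm (expsum c P \<bar>\<alpha>\<bar>) \<le> 8 * real P powr (c - 1) * B"
    using c by (simp add: expsum_def weight_def mult_ac)
  moreover have "norm (expsum c P \<bar>\<alpha>\<bar>) = norm (expsum c P \<alpha>)"
    using expsum_minus[of c P \<alpha>] by (simp add: abs_if)
  moreover have "8 * real P powr (c - 1) * B = 224 * real P powr (c - 1) * (\<bar>\<alpha>\<bar> * real P powr (c - 1) + 1)
            / sqrt (\<kappa> * (\<bar>\<alpha>\<bar> * real P powr (c - 2)))"
    by (simp add: B_def)
  ultimately show ?thesis by simp
qed

text \<open>
  On every step the increment of the primitive \<open>G\<close> is the step length times a value of \<open>\<phi>\<close>,
  which differs from \<open>\<phi> (y n)\<close> by at most \<open>K\<close> times the step.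
\<close>
lemma riemann_sum_error:
  fixes y :: "nat \<Rightarrow> real"
  assumes G: "\<And>t. (G has_real_derivative \<phi> t) (at t)"
    and lip: "\<And>s t. y 0 \<le> s \<Longrightarrow> s \<le> t \<Longrightarrow> t \<le> y P \<Longrightarrow> \<bar>\<phi> t - \<phi> s\<bar> \<le> K * (t - s)"
    and mono: "\<And>m n. m \<le> n \<Longrightarrow> y m \<le> y n" and step: "\<And>n. n < P \<Longrightarrow> y (Suc n) - y n \<le> \<Delta>"
    and "0 \<le> K"
  shows "\<bar>(\<Sum>n<P. (y (Suc n) - y n) * \<phi> (y n)) - (G (y P) - G (y 0))\<bar> \<le> K * \<Delta> * (y P - y 0)"
proof -
  have loc: "\<bar>(y (Suc n) - y n) * \<phi> (y n) - (G (y (Suc n)) - G (y n))\<bar> \<le> K * \<Delta> * (y (Suc n) - y n)"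
    if n: "n < P" for n
  proof (cases "y n < y (Suc n)")
    case True
    then obtain z where z: "y n < z" "z < y (Suc n)" "G (y (Suc n)) - G (y n) = (y (Suc n) - y n) * \<phi> z"
      using MVT2[of "y n" "y (Suc n)" G \<phi>] G by auto
    have "\<bar>\<phi> z - \<phi> (y n)\<bar> \<le> K * (z - y n)"
      using z mono[of 0 n] mono[of "Suc n" P] n by (intro lip) auto
    also have "\<dots> \<le> K * \<Delta>" using z step[OF n] \<open>0 \<le> K\<close> by (intro mult_left_mono) auto
    finally have "(y (Suc n) - y n) * \<bar>\<phi> (y n) - \<phi> z\<bar> \<le> (y (Suc n) - y n) * (K * \<Delta>)"
      using True by (intro mult_left_mono) auto
    moreover have "\<bar>(y (Suc n) - y n) * \<phi> (y n) - (G (y (Suc n)) - G (y n))\<bar>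
        = (y (Suc n) - y n) * \<bar>\<phi> (y n) - \<phi> z\<bar>"
      unfolding z(3) using True by (simp add: abs_mult flip: right_diff_distrib)
    ultimately show ?thesis by (simp add: mult_ac)
  qed (use mono[of n "Suc n"] in auto)
  have "(\<Sum>n<P. (y (Suc n) - y n) * \<phi> (y n)) - (G (y P) - G (y 0))
      = (\<Sum>n<P. (y (Suc n) - y n) * \<phi> (y n) - (G (y (Suc n)) - G (y n)))"
    using sum_lessThan_telescope[of "\<lambda>n. G (y n)" P] by (simp add: sum_subtractf)
  also have "\<bar>\<dots>\<bar> \<le> (\<Sum>n<P. K * \<Delta> * (y (Suc n) - y n))"
    by (rule order_trans[OF sum_abs]) (intro sum_mono loc, simp)
  also have "\<dots> = K * \<Delta> * (y P - y 0)"
    using sum_lessThan_telescope[of y P] by (simp flip: sum_distrib_left)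
  finally show ?thesis .
qed

lemma abs_cos_diff_le: "\<bar>cos x - cos y\<bar> \<le> \<bar>x - (y::real)\<bar>"
proof -
  have "\<bar>cos x - cos y\<bar> = 2 * \<bar>sin ((x + y) / 2)\<bar> * \<bar>sin ((y - x) / 2)\<bar>"
    by (simp add: cos_diff_cos abs_mult)
  also have "\<dots> \<le> 2 * 1 * \<bar>(y - x) / 2\<bar>"
    by (intro mult_mono abs_sin_x_le_abs_x) auto
  finally show ?thesis by simp
qed

lemma triangle_cos_lipschitz:
  fixes Y \<omega> :: real
  assumes "0 < Y" "0 \<le> \<omega>" "0 \<le> s" "s \<le> t" "t \<le> Y"
  shows "\<bar>(1 - t / Y) * cos (\<omega> * t) - (1 - s / Y) * cos (\<omega> * s)\<bar> \<le> (1 / Y + \<omega>) * (t - s)"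
proof -
  have "(1 - t / Y) * cos (\<omega> * t) - (1 - s / Y) * cos (\<omega> * s)
      = (1 - t / Y) * (cos (\<omega> * t) - cos (\<omega> * s)) + (s - t) / Y * cos (\<omega> * s)"
    by (simp add: diff_divide_distrib algebra_simps)
  also have "\<bar>\<dots>\<bar> \<le> \<bar>1 - t / Y\<bar> * \<bar>cos (\<omega> * t) - cos (\<omega> * s)\<bar> + \<bar>(s - t) / Y\<bar> * \<bar>cos (\<omega> * s)\<bar>"
    by (metis abs_mult abs_triangle_ineq)
  also have "\<dots> \<le> 1 * \<bar>\<omega> * t - \<omega> * s\<bar> + \<bar>(s - t) / Y\<bar> * 1"
    using assms by (intro add_mono mult_mono abs_cos_diff_le) (auto simp: field_simps)
  also have "\<dots> = (1 / Y + \<omega>) * (t - s)"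
  proof -
    have "\<bar>\<omega> * t - \<omega> * s\<bar> = \<omega> * (t - s)"
      using assms by (simp add: abs_of_nonneg mult_left_mono right_diff_distrib)
    moreover have "\<bar>(s - t) / Y\<bar> = 1 / Y * (t - s)" using assms by simp
    ultimately show ?thesis by (simp add: distrib_right)
  qed
  finally show ?thesis .
qed

lemma Re_expsum: "Re (expsum c P \<alpha>)
    = (\<Sum>n<P. gap c n * ((1 - real n powr c / real P powr c) * cos (2 * pi * \<alpha> * real n powr c)))"
  by (simp add: expsum_def weight_def Re_e mult_ac)

text \<open>
  The sum is a Riemann sum whose steps are at most 4 times \<open>P\<close> to the power \<open>c - 1\<close> for the function with
  primitive \<open>G\<close>.
\<close>
lemma Re_expsum_riemann:
  assumes c: "1 < c" "c < 2" and P: "1 \<le> P" and "0 \<le> \<xi>"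
    and G: "\<And>t. (G has_real_derivative (1 - t / real P powr c) * cos (2 * pi * \<xi> * t)) (at t)"
  shows "G (real P powr c) - G 0 - 4 * real P powr (c - 1) * (1 + 2 * pi * \<xi> * real P powr c)
    \<le> Re (expsum c P \<xi>)"
proof -
  define Y where "Y = real P powr c"
  have Y: "0 < Y" using P by (simp add: Y_def)
  let ?\<phi> = "\<lambda>t. (1 - t / Y) * cos (2 * pi * \<xi> * t)"
  let ?y = "\<lambda>n. real n powr c"
  have "\<bar>(\<Sum>n<P. (?y (Suc n) - ?y n) * ?\<phi> (?y n)) - (G (?y P) - G (?y 0))\<bar>
      \<le> (1 / Y + 2 * pi * \<xi>) * (4 * real P powr (c - 1)) * (?y P - ?y 0)"
  proof (rule riemann_sum_error)
    show "(G has_real_derivative ?\<phi> t) (at t)" for t using G Y_def by simp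
    show "\<bar>?\<phi> t - ?\<phi> s\<bar> \<le> (1 / Y + 2 * pi * \<xi>) * (t - s)"
      if "?y 0 \<le> s" "s \<le> t" "t \<le> ?y P" for s t
      using that c Y \<open>0 \<le> \<xi>\<close> by (intro triangle_cos_lipschitz) (auto simp: Y_def)
    show "?y (Suc n) - ?y n \<le> 4 * real P powr (c - 1)" if "n < P" for n
      using gap_upper[OF c, of "real n" P] that P by (simp add: gap_def add.commute)
  qed (use c Y \<open>0 \<le> \<xi>\<close> in \<open>auto intro: powr_mono2\<close>)
  moreover have "(\<Sum>n<P. (?y (Suc n) - ?y n) * ?\<phi> (?y n)) = Re (expsum c P \<xi>)"
    unfolding Re_expsum Y_def by (simp add: gap_def add.commute)
  moreover have "(1 / Y + 2 * pi * \<xi>) * (4 * real P powr (c - 1)) * (?y P - ?y 0)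
      = 4 * real P powr (c - 1) * (1 + 2 * pi * \<xi> * Y)"
    using Y c by (simp add: Y_def[symmetric] field_simps)
  ultimately have "\<bar>Re (expsum c P \<xi>) - (G (?y P) - G (?y 0))\<bar>
      \<le> 4 * real P powr (c - 1) * (1 + 2 * pi * \<xi> * Y)"
    by (simp only:)
  then show ?thesis using c unfolding Y_def by (simp add: abs_le_iff)
qed

text \<open>
  The integral being approximated is the Fourier transform of a triangle, hence nonnegative, so
  only the discretisation error survives. It serves for \<open>\<xi>\<close> near \<open>0\<close>, where the second difference
  test degenerates because its bound contains a term with \<open>sqrt \<xi>\<close> in the denominator.
\<close>
lemma Re_expsum_small_frequency:
  assumes c: "1 < c" "c < 2" and P: "1 \<le> P" and "0 < \<xi>"
  shows "- 4 * real P powr (c - 1) * (1 + 2 * pi * \<xi> * real P powr c) \<le> Re (expsum c P \<xi>)"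
proof -
  define Y where "Y = real P powr c"
  define \<omega> where "\<omega> = 2 * pi * \<xi>"
  have pos: "0 < Y" "0 < \<omega>" using P \<open>0 < \<xi>\<close> by (auto simp: Y_def \<omega>_def)
  \<comment> \<open>A primitive of the triangle times the cosine, found by integrating by parts.\<close>
  define G where "G = (\<lambda>t. (1 - t / Y) * (sin (\<omega> * t) / \<omega>) - cos (\<omega> * t) / (Y * \<omega>\<^sup>2))"
  have "(G has_real_derivative (1 - t / Y) * cos (\<omega> * t)) (at t)" for t
    unfolding G_def using pos
    by (auto intro!: derivative_eq_intros simp: field_simps power2_eq_square)
  from Re_expsum_riemann[OF c P _ this[unfolded Y_def \<omega>_def]] \<open>0 < \<xi>\<close>
  have "G Y - G 0 - 4 * real P powr (c - 1) * (1 + 2 * pi * \<xi> * real P powr c) \<le> Re (expsum c P \<xi>)"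
    by (simp add: Y_def)
  moreover have "G Y - G 0 = (1 - cos (\<omega> * Y)) / (Y * \<omega>\<^sup>2)"
    using pos by (simp add: G_def diff_divide_distrib)
  moreover have "0 \<le> (1 - cos (\<omega> * Y)) / (Y * \<omega>\<^sup>2)" using pos by simp
  ultimately show ?thesis by linarith
qed

lemma Re_expsum_zero:
  assumes c: "1 < c" "c < 2" and P: "1 \<le> P"
  shows "real P powr c / 2 - 4 * real P powr (c - 1) \<le> Re (expsum c P 0)"
proof -
  define Y where "Y = real P powr c"
  have Y: "0 < Y" using P by (simp add: Y_def)
  have "((\<lambda>t. t - t\<^sup>2 / (2 * Y)) has_real_derivative (1 - t / Y) * cos (2 * pi * 0 * t)) (at t)" for t
    using Y by (auto intro!: derivative_eq_intros simp: field_simps)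
  from Re_expsum_riemann[OF c P _ this[unfolded Y_def]]
  show ?thesis using Y by (simp add: Y_def[symmetric] power2_eq_square field_simps)
qed

section \<open>Removing the floor with a Fejer kernel\<close>

text \<open>
  The Fejer kernel, normalised to mean value 1 over a period.
\<close>
definition fejer :: "nat \<Rightarrow> real \<Rightarrow> real" where
  "fejer H u = (cmod (\<Sum>j<H. e (real j * u)))\<^sup>2 / real H"

lemma fejer_nonneg: "0 \<le> fejer H u" by (simp add: fejer_def)

lemma fejer_expand:
  "complex_of_real (fejer H u) = (\<Sum>j<H. \<Sum>k<H. e ((real j - real k) * u)) / of_nat H"
proof -
  have "complex_of_real ((cmod (\<Sum>j<H. e (real j * u)))\<^sup>2)
      = (\<Sum>j<H. e (real j * u)) * cnj (\<Sum>k<H. e (real k * u))"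
    by (rule complex_norm_square)
  also have "\<dots> = (\<Sum>j<H. \<Sum>k<H. e (real j * u) * e (- (real k * u)))"
    by (simp add: sum_product e_minus)
  finally show ?thesis by (simp add: fejer_def left_diff_distrib flip: e_add)
qed

lemma fejer_add_int: "fejer H (of_int m + u) = fejer H u"
proof -
  have "e (real j * (of_int m + u)) = e (real j * u)" for j
    using e_add[of "of_int (int j * m)" "real j * u"] e_of_int[of "int j * m"] by (simp add: distrib_left)
  then show ?thesis by (simp add: fejer_def)
qed

lemma e_minus_one: "cmod (1 - e u) = 2 * \<bar>sin (pi * u)\<bar>"
proof -
  have "(cmod (1 - e u))\<^sup>2 = (1 - cos (2 * pi * u))\<^sup>2 + (sin (2 * pi * u))\<^sup>2"
    by (simp add: cmod_power2 e_def)
  also have "\<dots> = 2 - 2 * cos (2 * pi * u)"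
    using sin_cos_squared_add[of "2 * pi * u"] by (simp add: power2_diff)
  also have "\<dots> = (2 * \<bar>sin (pi * u)\<bar>)\<^sup>2"
    using cos_double_sin[of "pi * u"] by (simp add: power_mult_distrib mult_ac)
  finally show ?thesis by (rule power2_eq_imp_eq) auto
qed

text \<open>
  The geometric sum \<open>(1 - e (H u)) / (1 - e u)\<close> has modulus at most \<open>1 / (2 \<bar>u\<bar>)\<close>.
\<close>
lemma fejer_concentration:
  assumes "\<bar>u\<bar> \<le> 1 / 2" "0 < H"
  shows "fejer H u * u\<^sup>2 \<le> 1 / (4 * real H)"
proof -
  let ?S = "\<Sum>j<H. e (real j * u)"
  have pw: "e (real j * u) = e u ^ j" for j
    by (induction j) (auto simp: distrib_right e_add)
  have "?S * (1 - e u) = 1 - e (real H * u)"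
    unfolding pw using one_diff_power_eq[of "e u" H] by (simp add: mult.commute)
  then have "cmod ?S * cmod (1 - e u) \<le> 2"
    using norm_triangle_ineq4[of 1 "e (real H * u)"] by (simp flip: norm_mult)
  moreover have "2 * \<bar>u\<bar> \<le> \<bar>sin (pi * u)\<bar>"
    using sin_pi_ge[of "\<bar>u\<bar>"] assms by (cases "0 \<le> u") auto
  then have "cmod ?S * (4 * \<bar>u\<bar>) \<le> cmod ?S * cmod (1 - e u)"
    by (intro mult_left_mono) (auto simp: e_minus_one)
  ultimately have "cmod ?S * \<bar>u\<bar> \<le> 1 / 2" by simp
  then have "(cmod ?S * \<bar>u\<bar>)\<^sup>2 \<le> (1 / 2)\<^sup>2" by (intro power_mono) auto
  then have "(cmod ?S)\<^sup>2 * u\<^sup>2 \<le> 1 / 4" by (simp add: power_mult_distrib power_divide)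
  then have "(cmod ?S)\<^sup>2 * u\<^sup>2 / real H \<le> 1 / 4 / real H" by (rule divide_right_mono) auto
  then show ?thesis by (simp add: fejer_def)
qed

lemma e_taylor: "cmod (e t - 1 - 2 * pi * t * \<i>) \<le> 4 * pi\<^sup>2 * t\<^sup>2"
proof -
  have "cmod (exp (2 * pi * t * \<i>) - (\<Sum>i\<le>1. (2 * pi * t * \<i>) ^ i / fact i))
      \<le> exp \<bar>Re (2 * pi * t * \<i>)\<bar> * cmod (2 * pi * t * \<i>) ^ Suc 1 / fact 1"
    by (rule Taylor_exp)
  then show ?thesis
    by (simp add: e_def cis_conv_exp mult_ac norm_mult power2_eq_square diff_diff_eq)
qed

text \<open>
  Linear interpolation between the values at \<open>\<xi> = 0\<close> and \<open>\<xi> = 1\<close>. Both sides have the same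
  first order Taylor polynomial in \<open>u\<close>. The gain is that \<open>e (- u)\<close> is 1-periodic in \<open>u\<close>, which
  \<open>e (- \<xi> * u)\<close> is not.
\<close>
lemma e_interpolation:
  assumes "0 \<le> \<xi>" "\<xi> \<le> 1"
  shows "cmod (e (- \<xi> * u) - (of_real (1 - \<xi>) + \<xi> * e (- u))) \<le> 8 * pi\<^sup>2 * u\<^sup>2"
proof -
  define r where "r = (\<lambda>t. e t - 1 - 2 * pi * t * \<i>)"
  have "e (- \<xi> * u) - (of_real (1 - \<xi>) + \<xi> * e (- u)) = r (- \<xi> * u) - \<xi> * r (- u)"
    by (simp add: r_def algebra_simps)
  also have "cmod \<dots> \<le> cmod (r (- \<xi> * u)) + \<xi> * cmod (r (- u))"
    using norm_triangle_ineq4[of "r (- \<xi> * u)" "\<xi> * r (- u)"] assms by (simp add: norm_mult)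
  also have "\<dots> \<le> 4 * pi\<^sup>2 * (- \<xi> * u)\<^sup>2 + \<xi> * (4 * pi\<^sup>2 * (- u)\<^sup>2)"
    unfolding r_def using assms by (intro add_mono mult_left_mono e_taylor)
  also have "\<dots> = 4 * pi\<^sup>2 * u\<^sup>2 * (\<xi>\<^sup>2 + \<xi>)"
    by (simp add: power_mult_distrib algebra_simps)
  also have "\<dots> \<le> 4 * pi\<^sup>2 * u\<^sup>2 * 2"
    using assms power_le_one[of \<xi> 2] by (intro mult_left_mono) auto
  finally show ?thesis by simp
qed

text \<open>
  The point \<open>y\<close> has distance \<open>u\<close> with \<open>\<bar>u\<bar> \<le> 1/2\<close> from the integer \<open>\<lfloor>x\<rfloor>\<close>; the shift by \<open>1/2\<close>
  keeps the jumps of the floor away from the peak of the kernel. The floor is traded for the two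
  frequencies \<open>\<xi>\<close> and \<open>\<xi> - 1\<close>.
\<close>
lemma fejer_floor_approx:
  fixes x y :: real
  assumes \<xi>: "0 \<le> \<xi>" "\<xi> \<le> 1" and "0 < H"
  defines "y \<equiv> x - 1 / 2"
  shows "cmod (fejer H y * e (\<xi> * of_int \<lfloor>x\<rfloor>)
      - fejer H y * (of_real (1 - \<xi>) * e (\<xi> * y) + \<xi> * e ((\<xi> - 1) * y))) \<le> 2 * pi\<^sup>2 / real H"
proof -
  define u where "u = y - of_int \<lfloor>x\<rfloor>"
  have u: "\<bar>u\<bar> \<le> 1 / 2" unfolding u_def y_def by linarith
  have y: "y = of_int \<lfloor>x\<rfloor> + u" by (simp add: u_def)
  have W: "fejer H y = fejer H u" unfolding y by (rule fejer_add_int)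
  have 1: "e (\<xi> * of_int \<lfloor>x\<rfloor>) = e (\<xi> * y) * e (- \<xi> * u)"
    by (simp add: y distrib_left flip: e_add)
  have "e (- y) = e (of_int (- \<lfloor>x\<rfloor>)) * e (- u)" by (simp add: y flip: e_add)
  then have "e (- y) = e (- u)" by (simp only: e_of_int mult_1)
  then have 2: "e ((\<xi> - 1) * y) = e (\<xi> * y) * e (- u)"
    using e_add[of "\<xi> * y" "- y"] by (simp add: left_diff_distrib)
  have "fejer H y * e (\<xi> * of_int \<lfloor>x\<rfloor>) - fejer H y * (of_real (1 - \<xi>) * e (\<xi> * y) + \<xi> * e ((\<xi> - 1) * y))
      = fejer H u * e (\<xi> * y) * (e (- \<xi> * u) - (of_real (1 - \<xi>) + \<xi> * e (- u)))"
    unfolding 1 2 W by (simp add: algebra_simps)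
  also have "cmod \<dots> = fejer H u * cmod (e (- \<xi> * u) - (of_real (1 - \<xi>) + \<xi> * e (- u)))"
    by (simp only: norm_mult norm_e norm_of_real fejer_nonneg abs_of_nonneg mult_1_right)
  also have "\<dots> \<le> fejer H u * (8 * pi\<^sup>2 * u\<^sup>2)"
    using e_interpolation[OF \<xi>, of u] fejer_nonneg[of H u] by (intro mult_left_mono)
  also have "\<dots> = 8 * pi\<^sup>2 * (fejer H u * u\<^sup>2)" by simp
  also have "\<dots> \<le> 8 * pi\<^sup>2 * (1 / (4 * real H))"
    using fejer_concentration[OF u \<open>0 < H\<close>] by (intro mult_left_mono) auto
  finally show ?thesis by simp
qed

text \<open>
  The sum \<open>expsum\<close> with the arguments shifted to the points \<open>n\<^sup>c - 1/2\<close>, where the Fejer kernel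
  is evaluated.
\<close>
definition halfsum :: "real \<Rightarrow> nat \<Rightarrow> real \<Rightarrow> complex" where
  "halfsum c P \<alpha> = (\<Sum>n<P. weight c P n * e (\<alpha> * (real n powr c - 1 / 2)))"

lemma halfsum_eq: "halfsum c P \<alpha> = e (- \<alpha> / 2) * expsum c P \<alpha>"
proof -
  have "e (\<alpha> * (real n powr c - 1 / 2)) = e (- \<alpha> / 2) * e (\<alpha> * real n powr c)" for n
    by (simp add: right_diff_distrib flip: e_add)
  then show ?thesis by (simp add: halfsum_def expsum_def sum_distrib_left mult_ac)
qed

lemma sum_fejer_e:
  "(\<Sum>n<P. weight c P n * (fejer H (real n powr c - 1 / 2) * e (\<alpha> * (real n powr c - 1 / 2))))
    = (\<Sum>j<H. \<Sum>k<H. halfsum c P (\<alpha> + (real j - real k))) / of_nat H"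
proof -
  have "(\<Sum>n<P. weight c P n * (fejer H (real n powr c - 1 / 2) * e (\<alpha> * (real n powr c - 1 / 2))))
    = (\<Sum>n<P. \<Sum>j<H. \<Sum>k<H. weight c P n * e ((\<alpha> + (real j - real k)) * (real n powr c - 1 / 2)) / of_nat H)"
    by (intro sum.cong refl)
       (simp add: fejer_expand distrib_right[of \<alpha>] e_add sum_distrib_left sum_distrib_right sum_divide_distrib mult_ac)
  also have "\<dots> = (\<Sum>j<H. \<Sum>n<P. \<Sum>k<H. weight c P n * e ((\<alpha> + (real j - real k)) * (real n powr c - 1 / 2)) / of_nat H)"
    by (rule sum.swap)
  also have "\<dots> = (\<Sum>j<H. \<Sum>k<H. \<Sum>n<P. weight c P n * e ((\<alpha> + (real j - real k)) * (real n powr c - 1 / 2)) / of_nat H)"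
    by (intro sum.cong refl sum.swap)
  finally show ?thesis by (simp add: halfsum_def sum_divide_distrib)
qed

definition fejer_weight :: "real \<Rightarrow> nat \<Rightarrow> nat \<Rightarrow> nat \<Rightarrow> real" where
  "fejer_weight c P H n = weight c P n * fejer H (real n powr c - 1 / 2)"

lemma sum_fejer_weight_approx:
  assumes c: "1 < c" and \<xi>: "0 \<le> \<xi>" "\<xi> \<le> 1" and "0 < H"
  shows "cmod ((\<Sum>n<P. fejer_weight c P H n * e (\<xi> * of_int \<lfloor>real n powr c\<rfloor>))
      - (\<Sum>j<H. \<Sum>k<H. of_real (1 - \<xi>) * halfsum c P (\<xi> + (real j - real k))
          + \<xi> * halfsum c P (\<xi> - 1 + (real j - real k))) / of_nat H)
     \<le> 2 * pi\<^sup>2 * real P powr c / real H"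
proof -
  define y where "y = (\<lambda>n. real n powr c - 1 / 2)"
  define W where "W = (\<lambda>n. fejer H (y n))"
  define p where "p = (\<lambda>n. of_real (1 - \<xi>) * e (\<xi> * y n) + \<xi> * e ((\<xi> - 1) * y n))"
  define q where "q = (\<lambda>n. e (\<xi> * of_int \<lfloor>real n powr c\<rfloor>))"
  define h where "h = halfsum c P"
  have fej: "(\<Sum>j<H. \<Sum>k<H. h (\<alpha> + (real j - real k))) / of_nat H
      = (\<Sum>n<P. weight c P n * (W n * e (\<alpha> * y n)))" for \<alpha>
    using sum_fejer_e[where c=c and P=P and H=H and \<alpha>=\<alpha>] by (simp only: h_def W_def y_def)
  have "(\<Sum>j<H. \<Sum>k<H. of_real (1 - \<xi>) * h (\<xi> + (real j - real k)) + \<xi> * h (\<xi> - 1 + (real j - real k))) / of_nat H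
      = of_real (1 - \<xi>) * ((\<Sum>j<H. \<Sum>k<H. h (\<xi> + (real j - real k))) / of_nat H)
        + \<xi> * ((\<Sum>j<H. \<Sum>k<H. h (\<xi> - 1 + (real j - real k))) / of_nat H)"
    by (simp only: sum.distrib sum_distrib_left[symmetric] add_divide_distrib times_divide_eq_right)
  also have "\<dots> = (\<Sum>n<P. weight c P n * (W n * p n))"
    unfolding fej sum_distrib_left sum.distrib[symmetric]
    by (intro sum.cong refl) (simp only: p_def distrib_left mult_ac)
  finally have 1: "(\<Sum>j<H. \<Sum>k<H. of_real (1 - \<xi>) * h (\<xi> + (real j - real k)) + \<xi> * h (\<xi> - 1 + (real j - real k))) / of_nat H
      = (\<Sum>n<P. weight c P n * (W n * p n))" .
  have 2: "(\<Sum>n<P. fejer_weight c P H n * q n) = (\<Sum>n<P. weight c P n * (W n * q n))"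
    by (simp add: fejer_weight_def W_def y_def mult.assoc)
  have "cmod (\<Sum>n<P. weight c P n * (W n * q n - W n * p n)) \<le> (\<Sum>n<P. weight c P n * (2 * pi\<^sup>2 / real H))"
  proof (intro sum_norm_le)
    fix n assume n: "n \<in> {..<P}"
    then have w: "0 \<le> weight c P n" using weight_bounds(1)[OF c] by auto
    have "cmod (W n * q n - W n * p n) \<le> 2 * pi\<^sup>2 / real H"
      unfolding W_def p_def q_def y_def using \<xi> \<open>0 < H\<close> by (intro fejer_floor_approx)
    then show "cmod (weight c P n * (W n * q n - W n * p n)) \<le> weight c P n * (2 * pi\<^sup>2 / real H)"
      unfolding norm_mult norm_of_real abs_of_nonneg[OF w] using w by (rule mult_left_mono)
  qed
  also have "\<dots> = (\<Sum>n<P. weight c P n) * (2 * pi\<^sup>2 / real H)" by (simp only: sum_distrib_right)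
  also have "\<dots> \<le> real P powr c * (2 * pi\<^sup>2 / real H)"
    using sum_weight_le[OF c] by (intro mult_right_mono) auto
  finally have 3: "cmod (\<Sum>n<P. weight c P n * (W n * q n - W n * p n)) \<le> 2 * pi\<^sup>2 * real P powr c / real H"
    by (simp add: mult_ac)
  have "cmod ((\<Sum>n<P. fejer_weight c P H n * q n) - (\<Sum>j<H. \<Sum>k<H. of_real (1 - \<xi>) * h (\<xi> + (real j - real k))
      + \<xi> * h (\<xi> - 1 + (real j - real k))) / of_nat H) \<le> 2 * pi\<^sup>2 * real P powr c / real H"
    unfolding 1 2 using 3 by (simp only: right_diff_distrib sum_subtractf)
  then show ?thesis unfolding h_def q_def .
qed

text \<open>
  Among the \<open>H\<^sup>2\<close> pairs, exactly \<open>H\<close> lie on the diagonal and fewer than \<open>H\<close> just below it; for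
  these the second hypothesis fixes the direction of the estimate.
\<close>
lemma double_sum_lower:
  fixes T :: "nat \<Rightarrow> nat \<Rightarrow> real"
  assumes "\<And>j k. j < H \<Longrightarrow> k < H \<Longrightarrow>
      (if j = k then d0 else 0) + (if j = Suc k then d1 else 0) - B \<le> T j k"
    and "d1 \<le> 0" "0 < H"
  shows "d0 + d1 - H * B \<le> (\<Sum>j<H. \<Sum>k<H. T j k) / H"
proof -
  have "H * d1 \<le> (\<Sum>k<H. if Suc k < H then d1 else 0)"
    using sum_bounded_below[of "{..<H}" d1 "\<lambda>k. if Suc k < H then d1 else 0"] \<open>d1 \<le> 0\<close> by simp
  also have "\<dots> = (\<Sum>k<H. \<Sum>j<H. if j = Suc k then d1 else 0)"
    by (intro sum.cong refl) simp
  also have "\<dots> = (\<Sum>j<H. \<Sum>k<H. if j = Suc k then d1 else 0)"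
    by (rule sum.swap)
  finally have "H * (d0 + d1 - H * B)
      \<le> (\<Sum>j<H. \<Sum>k<H. (if j = k then d0 else 0) + (if j = Suc k then d1 else 0) - B)"
    by (simp add: sum.distrib sum_subtractf algebra_simps)
  also have "\<dots> \<le> (\<Sum>j<H. \<Sum>k<H. T j k)"
    using assms(1) by (intro sum_mono) auto
  finally show ?thesis using \<open>0 < H\<close> by (simp add: field_simps)
qed

lemma shifted_frequency_bounds:
  fixes \<xi> :: real and m :: int
  assumes "0 \<le> \<xi>" "\<xi> \<le> 1 / 2" "m \<noteq> 0" "\<bar>m\<bar> \<le> int H" "m < int H"
  shows "1 / 2 \<le> \<bar>\<xi> + of_int m\<bar>" "\<bar>\<xi> + of_int m\<bar> \<le> real H"
proof -
  consider "1 \<le> m" | "m \<le> - 1" using assms by linarith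
  then have "(1 / 2 \<le> \<bar>\<xi> + of_int m\<bar>) \<and> \<bar>\<xi> + of_int m\<bar> \<le> real H"
  proof cases
    case 1
    then have "1 \<le> real_of_int m" by simp
    moreover have "real_of_int m \<le> real H - 1" using assms by linarith
    ultimately show ?thesis using assms by auto
  next
    case 2
    then have "real_of_int m \<le> -1" by simp
    moreover have "- real H \<le> real_of_int m" using assms by linarith
    ultimately show ?thesis using assms by auto
  qed
  then show "1 / 2 \<le> \<bar>\<xi> + of_int m\<bar>" "\<bar>\<xi> + of_int m\<bar> \<le> real H" by auto
qed

text \<open>
  The sum is an average over pairs \<open>(j, k)\<close> of values of \<open>halfsum\<close> at \<open>\<xi> + (j - k)\<close> and
  \<open>\<xi> - 1 + (j - k)\<close>. The frequency is \<open>\<xi>\<close> itself only for \<open>j = k\<close> and for \<open>j = k + 1\<close>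
  respectively, where the lower bound \<open>- D\<close> enters; all other frequencies are at least \<open>1/2\<close> in
  modulus and cost at most \<open>B\<close> each.
\<close>
lemma fejer_weight_sum_lower:
  assumes c: "1 < c" and \<xi>: "0 \<le> \<xi>" "\<xi> \<le> 1 / 2" and H: "0 < H"
    and B: "0 \<le> B" "\<And>\<alpha>. 1 / 2 \<le> \<bar>\<alpha>\<bar> \<Longrightarrow> \<bar>\<alpha>\<bar> \<le> real H \<Longrightarrow> cmod (expsum c P \<alpha>) \<le> B"
    and D: "0 \<le> D" "- D \<le> Re (halfsum c P \<xi>)"
  shows "- (H * B + 2 * D + 2 * pi\<^sup>2 * real P powr c / real H)
    \<le> (\<Sum>n<P. fejer_weight c P H n * cos (2 * pi * of_int \<lfloor>real n powr c\<rfloor> * \<xi>))"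
proof -
  let ?T = "\<lambda>j k. (1 - \<xi>) * Re (halfsum c P (\<xi> + (real j - real k)))
          + \<xi> * Re (halfsum c P (\<xi> - 1 + (real j - real k)))"
  have far: "- B \<le> Re (halfsum c P (\<xi> + of_int m))"
    if "m \<noteq> 0" "\<bar>m\<bar> \<le> int H" "m < int H" for m :: int
  proof -
    have "cmod (halfsum c P (\<xi> + of_int m)) \<le> B"
      using B(2) shifted_frequency_bounds[OF \<xi> that] by (simp add: halfsum_eq norm_mult)
    then show ?thesis using abs_Re_le_cmod[of "halfsum c P (\<xi> + of_int m)"] by linarith
  qed
  have gen: "(if m = 0 then - D else 0) - B \<le> Re (halfsum c P (\<xi> + of_int m))"
    if "\<bar>m\<bar> \<le> int H" "m < int H" for m :: int
    using far[of m] that D B(1) by (cases "m = 0") auto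
  have "- D + - D - H * B \<le> (\<Sum>j<H. \<Sum>k<H. ?T j k) / H"
  proof (rule double_sum_lower)
    fix j k assume jk: "j < H" "k < H"
    let ?a = "if j = k then - D else 0" and ?b = "if j = Suc k then - D else 0"
    have 1: "?a - B \<le> Re (halfsum c P (\<xi> + (real j - real k)))"
      using gen[of "int j - int k"] jk by (auto split: if_splits)
    have 2: "?b - B \<le> Re (halfsum c P (\<xi> - 1 + (real j - real k)))"
      using gen[of "int j - int k - 1"] jk by (auto split: if_splits simp: algebra_simps)
    have "(1 - \<xi>) * (?a - B) + \<xi> * (?b - B) \<le> ?T j k"
      using \<xi> 1 2 by (intro add_mono mult_left_mono) auto
    moreover have "?a \<le> (1 - \<xi>) * ?a" "?b \<le> \<xi> * ?b"
      using mult_left_le_one_le[OF D(1), of \<xi>] mult_left_le_one_le[OF D(1), of "1 - \<xi>"] \<xi> by auto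
    moreover have "(1 - \<xi>) * (?a - B) + \<xi> * (?b - B) = (1 - \<xi>) * ?a + \<xi> * ?b - B"
      by (simp add: algebra_simps)
    ultimately show "?a + ?b - B \<le> ?T j k" by linarith
  qed (use D H in auto)
  then have 1: "- D + - D - H * B \<le> Re ((\<Sum>j<H. \<Sum>k<H. of_real (1 - \<xi>) * halfsum c P (\<xi> + (real j - real k))
          + \<xi> * halfsum c P (\<xi> - 1 + (real j - real k))) / of_nat H)" (is "_ \<le> Re ?b")
    by (simp add: Re_divide_of_nat)
  have 2: "Re (\<Sum>n<P. fejer_weight c P H n * e (\<xi> * of_int \<lfloor>real n powr c\<rfloor>))
      = (\<Sum>n<P. fejer_weight c P H n * cos (2 * pi * of_int \<lfloor>real n powr c\<rfloor> * \<xi>))" (is "Re ?a = _")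
    by (simp add: Re_e mult_ac)
  have "cmod (?a - ?b) \<le> 2 * pi\<^sup>2 * real P powr c / real H"
    using \<xi> by (intro sum_fejer_weight_approx[OF c _ _ H]) auto
  then have "Re ?b - Re ?a \<le> 2 * pi\<^sup>2 * real P powr c / real H"
    using abs_Re_le_cmod[of "?a - ?b"] unfolding minus_complex.sel by linarith
  then show ?thesis using 1 unfolding 2 by linarith
qed

text \<open>
  At frequency \<open>0\<close> no floor has to be removed, so the Fejer expansion is exact and its diagonal
  contributes the full sum of \<open>weight c P n\<close>.
\<close>
lemma fejer_weight_mass_lower:
  assumes c: "1 < c" and H: "0 < H"
    and B: "0 \<le> B" "\<And>\<alpha>. 1 / 2 \<le> \<bar>\<alpha>\<bar> \<Longrightarrow> \<bar>\<alpha>\<bar> \<le> real H \<Longrightarrow> cmod (expsum c P \<alpha>) \<le> B"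
  shows "Re (expsum c P 0) - H * B \<le> (\<Sum>n<P. fejer_weight c P H n)"
proof -
  have "Re (expsum c P 0) + 0 - H * B \<le> (\<Sum>j<H. \<Sum>k<H. Re (halfsum c P (0 + (real j - real k)))) / H"
  proof (rule double_sum_lower)
    fix j k assume jk: "j < H" "k < H"
    show "(if j = k then Re (expsum c P 0) else 0) + (if j = Suc k then 0 else 0) - B
        \<le> Re (halfsum c P (0 + (real j - real k)))"
    proof (cases "j = k")
      case False
      have "cmod (halfsum c P (real j - real k)) \<le> B"
        using B(2) shifted_frequency_bounds[of 0 "int j - int k" H] jk False
        by (simp add: halfsum_eq norm_mult)
      then show ?thesis using abs_Re_le_cmod[of "halfsum c P (real j - real k)"] False by auto
    qed (use B in \<open>simp add: halfsum_eq\<close>)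
  qed (use H in auto)
  also have "\<dots> = Re ((\<Sum>j<H. \<Sum>k<H. halfsum c P (0 + (real j - real k))) / of_nat H)"
    by (simp add: Re_divide_of_nat)
  also have "\<dots> = (\<Sum>n<P. fejer_weight c P H n)"
    unfolding sum_fejer_e[symmetric] by (simp add: fejer_weight_def)
  finally show ?thesis by simp
qed

section \<open>Cosine polynomials and sets without differences in a given set\<close>

lemma sum_cos_roots_of_unity:
  fixes m :: int
  assumes "0 < q"
  shows "(\<Sum>j<q. cos (2 * pi * of_int m * (real j / real q))) = (if int q dvd m then real q else 0)"
proof (cases "int q dvd m")
  case True
  then obtain l where l: "m = int q * l" by auto
  have "cos (2 * pi * of_int m * (real j / real q)) = 1" for j
    using cos_int_2pin[of "l * int j"] assms by (simp add: l mult_ac)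
  then show ?thesis using True by simp
next
  case False
  define w where "w = e (of_int m / real q)"
  have "w \<noteq> 1"
  proof
    assume "w = 1"
    then have "cos (2 * pi * (of_int m / real q)) = 1" by (metis Re_e one_complex.sel(1) w_def)
    then obtain k :: int where "2 * pi * (of_int m / real q) = of_int k * 2 * pi"
      using cos_one_2pi_int by blast
    then have "of_int m = real_of_int k * real q" using assms by (simp add: field_simps)
    then have "m = k * int q" by (metis of_int_eq_iff of_int_mult of_int_of_nat_eq)
    then show False using False by simp
  qed
  have pw: "e (of_int m * (real j / real q)) = w ^ j" for j
    by (induction j) (auto simp: w_def add_divide_distrib distrib_left e_add)
  have "w ^ q = 1" using pw[of q] assms by simp
  then have "(\<Sum>j<q. w ^ j) = 0" using \<open>w \<noteq> 1\<close> by (simp add: sum_gp_strict)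
  moreover have "cos (2 * pi * of_int m * (real j / real q)) = Re (w ^ j)" for j
    unfolding pw[symmetric] Re_e by (simp add: mult_ac)
  ultimately have "(\<Sum>j<q. cos (2 * pi * of_int m * (real j / real q))) = 0"
    by (simp flip: Re_sum)
  then show ?thesis using False by simp
qed

lemma sum_cos_differences:
  fixes A :: "int set" and t :: real
  shows "(\<Sum>x\<in>A. \<Sum>y\<in>A. cos (of_int (x - y) * t)) = (\<Sum>x\<in>A. cos (of_int x * t))\<^sup>2 + (\<Sum>x\<in>A. sin (of_int x * t))\<^sup>2"
  by (simp only: power2_eq_square sum_product of_int_diff left_diff_distrib cos_diff sum.distrib)

text \<open>
  Sum \<open>\<bar>\<Sum>x\<in>A. e (x t)\<bar>\<^sup>2 * T t\<close> over \<open>t = j / q\<close> with \<open>q = 2 N\<close>. All terms are nonnegative,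
  and \<open>t = 0\<close> gives \<open>(card A)\<^sup>2\<close>. By orthogonality the constant coefficient contributes
  \<open>q * a 0 * card A\<close>. The modulus \<open>2 N\<close> exceeds every \<open>\<bar>x - y \<plusminus> s\<bar>\<close>, so the coefficient at \<open>s\<close>
  could only be seen by pairs in \<open>A\<close> with difference \<open>s\<close>, of which there are none.
\<close>
lemma card_le_constant_coefficient:
  assumes N: "1 \<le> N" and F: "F \<subseteq> {1..int N}" and a: "a \<in> nonneg_cos_polys F"
    and A: "A \<subseteq> {1..int N}" "A \<noteq> {}"
    and free: "\<And>x s. x \<in> A \<Longrightarrow> s \<in> F \<Longrightarrow> x + s \<notin> A"
  shows "real (card A) \<le> 2 * real N * a 0"
proof -
  define q where "q = 2 * N"
  have q: "0 < q" using N by (simp add: q_def)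
  have fin: "finite A" "finite F" using A F finite_subset by blast+
  define R where "R = (\<lambda>j::nat. \<Sum>x\<in>A. \<Sum>y\<in>A. cos (2 * pi * of_int (x - y) * (real j / real q)))"
  have R: "0 \<le> R j" for j
  proof -
    have "R j = (\<Sum>x\<in>A. \<Sum>y\<in>A. cos (of_int (x - y) * (2 * pi * (real j / real q))))"
      by (simp only: R_def mult_ac)
    then show ?thesis unfolding sum_cos_differences by simp
  qed
  have T: "0 \<le> cos_poly F a \<xi>" "cos_poly F a 0 = 1" for \<xi>
    using a by (auto simp: nonneg_cos_polys_def)
  have not_dvd: "\<not> int q dvd m" if "m \<noteq> 0" "\<bar>m\<bar> < int q" for m
    using dvd_imp_le_int[of m "int q"] that by auto
  have vanish: "(\<Sum>j<q. cos (2 * pi * of_int (x - y) * (real j / real q)) * cos (2 * pi * of_int s * (real j / real q))) = 0"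
    if "x \<in> A" "y \<in> A" "s \<in> F" for x y s
  proof -
    have xy: "x \<in> {1..int N}" "y \<in> {1..int N}" "s \<in> {1..int N}" using that A F by auto
    have "y \<noteq> x + s" "x \<noteq> y + s" using free[of x s] free[of y s] that by auto
    then have "x - y + s \<noteq> 0" "x - y - s \<noteq> 0" by linarith+
    moreover have "\<bar>x - y + s\<bar> < int q" "\<bar>x - y - s\<bar> < int q"
      using xy unfolding q_def by auto
    ultimately have "\<not> int q dvd (x - y + s)" "\<not> int q dvd (x - y - s)"
      using not_dvd by blast+
    then have "(\<Sum>j<q. cos (2 * pi * of_int (x - y + s) * (real j / real q))) = 0"
        "(\<Sum>j<q. cos (2 * pi * of_int (x - y - s) * (real j / real q))) = 0"
      using sum_cos_roots_of_unity[OF q] by presburger+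
    moreover have "cos (2 * pi * of_int (x - y) * t) * cos (2 * pi * of_int s * t)
        = cos (2 * pi * of_int (x - y + s) * t) / 2 + cos (2 * pi * of_int (x - y - s) * t) / 2" for t
      using cos_times_cos[of "2 * pi * of_int (x - y) * t" "2 * pi * of_int s * t"]
      by (simp add: algebra_simps add_divide_distrib)
    ultimately show ?thesis
      by (simp only: sum.distrib sum_divide_distrib[symmetric] div_0 add_0_right)
  qed
  have diag: "(\<Sum>j<q. cos (2 * pi * of_int (x - y) * (real j / real q))) = (if x = y then real q else 0)"
    if "x \<in> A" "y \<in> A" for x y
  proof -
    have "int q dvd (x - y) \<longleftrightarrow> x = y"
    proof (cases "x = y")
      case False
      moreover have "x \<in> {1..int N}" "y \<in> {1..int N}" using that A by auto
      ultimately have "\<not> int q dvd (x - y)" by (intro not_dvd) (auto simp: q_def)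
      then show ?thesis using False by simp
    qed simp
    then show ?thesis using sum_cos_roots_of_unity[OF q] by presburger
  qed
  have "(real (card A))\<^sup>2 = R 0 * cos_poly F a (real 0 / real q)"
    using T(2) by (simp add: R_def power2_eq_square)
  also have "\<dots> \<le> (\<Sum>j<q. R j * cos_poly F a (real j / real q))"
    using q R T(1) by (intro member_le_sum) auto
  also have "\<dots> = a 0 * (\<Sum>j<q. R j) + (\<Sum>s\<in>F. a s * (\<Sum>j<q. R j * cos (2 * pi * of_int s * (real j / real q))))"
    unfolding cos_poly_def sum_distrib_left distrib_left sum.distrib
    by (subst sum.swap[of _ F]) (simp add: mult_ac)
  also have "(\<Sum>j<q. R j) = (\<Sum>x\<in>A. \<Sum>y\<in>A. \<Sum>j<q. cos (2 * pi * of_int (x - y) * (real j / real q)))"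
    unfolding R_def by (subst sum.swap) (intro sum.cong refl sum.swap)
  also have "\<dots> = (\<Sum>x\<in>A. \<Sum>y\<in>A. if x = y then real q else 0)"
    by (intro sum.cong refl diag)
  also have "\<dots> = real q * real (card A)" using fin by simp
  also have "(\<Sum>s\<in>F. a s * (\<Sum>j<q. R j * cos (2 * pi * of_int s * (real j / real q)))) = 0"
  proof (intro sum.neutral ballI)
    fix s assume s: "s \<in> F"
    have "(\<Sum>j<q. R j * cos (2 * pi * of_int s * (real j / real q)))
        = (\<Sum>x\<in>A. \<Sum>y\<in>A. \<Sum>j<q. cos (2 * pi * of_int (x - y) * (real j / real q)) * cos (2 * pi * of_int s * (real j / real q)))"
      unfolding R_def sum_distrib_right by (subst sum.swap) (intro sum.cong refl sum.swap)
    also have "\<dots> = 0" by (intro sum.neutral ballI vanish s)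
    finally show "a s * (\<Sum>j<q. R j * cos (2 * pi * of_int s * (real j / real q))) = 0" by simp
  qed
  finally have "real (card A) * real (card A) \<le> (2 * real N * a 0) * real (card A)"
    by (simp add: q_def power2_eq_square mult_ac)
  moreover have "0 < real (card A)" using fin A by (simp add: card_gt_0_iff)
  ultimately show ?thesis by simp
qed

text \<open>
  The singleton \<open>{1}\<close> has no positive differences at all.
\<close>
lemma constant_coefficient_pos:
  assumes "1 \<le> N" "F \<subseteq> {1..int N}" "a \<in> nonneg_cos_polys F"
  shows "0 < a 0"
proof -
  have "real (card {1::int}) \<le> 2 * real N * a 0"
    using assms by (intro card_le_constant_coefficient) auto
  then have "0 < 2 * real N * a 0" by simp
  then show ?thesis using assms(1) by (simp add: zero_less_mult_iff)
qed

lemma cos_poly_from_frequencies: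
  fixes f :: "'i \<Rightarrow> int" and p :: "'i \<Rightarrow> real" and E Z :: real
  assumes I: "finite I" and F: "finite F" "0 \<notin> F" "f ` I \<subseteq> insert 0 F"
  defines "a \<equiv> \<lambda>s. ((\<Sum>i\<in>{i\<in>I. f i = s}. p i) + (if s = 0 then E else 0)) / Z"
  shows "cos_poly F a \<xi> = ((\<Sum>i\<in>I. p i * cos (2 * pi * of_int (f i) * \<xi>)) + E) / Z"
proof -
  have "(\<Sum>i\<in>I. p i * cos (2 * pi * of_int (f i) * \<xi>))
      = (\<Sum>s\<in>insert 0 F. \<Sum>i\<in>{i\<in>I. f i = s}. p i * cos (2 * pi * of_int (f i) * \<xi>))"
    using I F by (intro sum.group[symmetric]) auto
  also have "\<dots> = (\<Sum>s\<in>insert 0 F. (\<Sum>i\<in>{i\<in>I. f i = s}. p i) * cos (2 * pi * of_int s * \<xi>))"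
    unfolding sum_distrib_right by (intro sum.cong refl) auto
  also have "\<dots> = (\<Sum>i\<in>{i\<in>I. f i = 0}. p i)
      + (\<Sum>s\<in>F. (\<Sum>i\<in>{i\<in>I. f i = s}. p i) * cos (2 * pi * of_int s * \<xi>))"
    using F by simp
  finally have eq: "(\<Sum>i\<in>I. p i * cos (2 * pi * of_int (f i) * \<xi>)) = \<dots>" .
  have "(\<Sum>s\<in>F. a s * cos (2 * pi * of_int s * \<xi>))
      = (\<Sum>s\<in>F. (\<Sum>i\<in>{i\<in>I. f i = s}. p i) * cos (2 * pi * of_int s * \<xi>)) / Z"
    unfolding sum_divide_distrib using F by (intro sum.cong refl) (auto simp: a_def)
  then show ?thesis unfolding cos_poly_def eq by (simp add: a_def add_divide_distrib)
qed

lemma gamma_S_le: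
  fixes f :: "'i \<Rightarrow> int" and p :: "'i \<Rightarrow> real"
  assumes N: "1 \<le> N" and I: "finite I" and f: "f ` I \<subseteq> insert 0 (S \<inter> {1..int N})"
    and lower: "\<And>\<xi>. - E \<le> (\<Sum>i\<in>I. p i * cos (2 * pi * of_int (f i) * \<xi>))"
    and pos: "0 < (\<Sum>i\<in>I. p i) + E"
  shows "gamma_S S N \<le> ((\<Sum>i\<in>{i\<in>I. f i = 0}. p i) + E) / ((\<Sum>i\<in>I. p i) + E)"
proof -
  let ?F = "S \<inter> {1..int N}"
  define Z where "Z = (\<Sum>i\<in>I. p i) + E"
  \<comment> \<open>The coefficients of \<open>(F + E) / (F 0 + E)\<close>.\<close>
  define a where "a = (\<lambda>s. ((\<Sum>i\<in>{i\<in>I. f i = s}. p i) + (if s = 0 then E else 0)) / Z)"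
  have cp: "cos_poly ?F a \<xi> = ((\<Sum>i\<in>I. p i * cos (2 * pi * of_int (f i) * \<xi>)) + E) / Z" for \<xi>
    unfolding a_def using I f by (intro cos_poly_from_frequencies) auto
  have "0 \<le> cos_poly ?F a \<xi>" for \<xi>
    unfolding cp using lower[of \<xi>] pos by (auto simp: Z_def intro!: divide_nonneg_pos)
  moreover have "cos_poly ?F a 0 = 1" unfolding cp using pos by (simp add: Z_def)
  ultimately have "a \<in> nonneg_cos_polys ?F" by (simp add: nonneg_cos_polys_def)
  moreover have "bdd_below ((\<lambda>a. a 0) ` nonneg_cos_polys ?F)"
    using constant_coefficient_pos[OF N, of ?F] by (intro bdd_belowI2[of _ 0]) (auto intro: less_imp_le)
  ultimately have "gamma_S S N \<le> a 0" unfolding gamma_S_def by (rule cINF_lower[rotated])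
  then show ?thesis by (simp add: a_def Z_def)
qed

lemma nonneg_cos_polys_nonempty: "nonneg_cos_polys (S \<inter> {1..int N}) \<noteq> {}"
proof -
  have "(\<lambda>s. if s = 0 then 1 else 0) \<in> nonneg_cos_polys (S \<inter> {1..int N})"
    by (auto simp: nonneg_cos_polys_def cos_poly_def intro!: sum.neutral sum_nonneg)
  then show ?thesis by blast
qed

lemma gamma_S_nonneg:
  assumes "1 \<le> N"
  shows "0 \<le> gamma_S S N"
  unfolding gamma_S_def using constant_coefficient_pos[OF assms, of "S \<inter> {1..int N}"]
  by (intro cINF_greatest nonneg_cos_polys_nonempty) (auto intro: less_imp_le)

lemma card_le_gamma_S:
  assumes N: "1 \<le> N" and A: "A \<subseteq> {1..int N}"
    and free: "\<And>x s. x \<in> A \<Longrightarrow> s \<in> S \<Longrightarrow> x + s \<notin> A"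
  shows "real (card A) \<le> 2 * real N * gamma_S S N"
proof (cases "A = {}")
  case False
  have "real (card A) / (2 * real N) \<le> gamma_S S N"
    unfolding gamma_S_def
  proof (intro cINF_greatest nonneg_cos_polys_nonempty)
    fix a assume "a \<in> nonneg_cos_polys (S \<inter> {1..int N})"
    then have "real (card A) \<le> 2 * real N * a 0"
      using N A False free by (intro card_le_constant_coefficient) auto
    then show "real (card A) / (2 * real N) \<le> a 0" using N by (simp add: field_simps)
  qed
  then show ?thesis using N by (simp add: field_simps)
qed (use N gamma_S_nonneg in simp)

section \<open>The bound for the sequence of floor powers\<close>

lemma expsum_le_two_terms:
  assumes c: "1 < c" "c < 2" and P: "1 \<le> P"
    and \<alpha>: "\<alpha> \<noteq> 0" "\<bar>\<alpha>\<bar> * real P powr (c - 2) \<le> 1"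
  defines "K \<equiv> 224 / sqrt (c * (c - 1) / 2)"
  shows "cmod (expsum c P \<alpha>)
      \<le> K * (sqrt \<bar>\<alpha>\<bar> * real P powr (3 * c / 2 - 1) + real P powr (c / 2) / sqrt \<bar>\<alpha>\<bar>)"
proof -
  define p where "p = real P"
  define s where "s = sqrt \<bar>\<alpha>\<bar>"
  define r where "r = p powr (c / 2 - 1)"
  have p: "0 < p" using P by (simp add: p_def)
  have s: "0 < s" "\<bar>\<alpha>\<bar> = s * s" using \<alpha> by (auto simp: s_def)
  have r: "0 < r" "p powr (c - 2) = r * r" using p by (auto simp: r_def simp flip: powr_add)
  have a: "p powr (c - 1) = r * p powr (c / 2)" "r * p powr (c / 2) * p powr (c / 2) = p powr (3 * c / 2 - 1) * 1"
    using p by (auto simp: r_def simp flip: powr_add)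
  have "cmod (expsum c P \<alpha>) \<le> 224 * p powr (c - 1) * (\<bar>\<alpha>\<bar> * p powr (c - 1) + 1)
            / sqrt (c * (c - 1) / 2 * (\<bar>\<alpha>\<bar> * p powr (c - 2)))"
    using expsum_bound[OF c P \<alpha>] by (simp add: p_def)
  also have "sqrt (c * (c - 1) / 2 * (\<bar>\<alpha>\<bar> * p powr (c - 2))) = sqrt (c * (c - 1) / 2) * (s * r)"
    unfolding s r using s(1) r(1) by (simp only: real_sqrt_mult real_sqrt_mult_self abs_of_pos)
  also have "224 * p powr (c - 1) * (\<bar>\<alpha>\<bar> * p powr (c - 1) + 1) / (sqrt (c * (c - 1) / 2) * (s * r))
      = K * (p powr (c - 1) * (\<bar>\<alpha>\<bar> * p powr (c - 1) + 1) / (s * r))"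
    by (simp add: K_def)
  also have "p powr (c - 1) * (\<bar>\<alpha>\<bar> * p powr (c - 1) + 1) / (s * r)
      = s * (r * p powr (c / 2) * p powr (c / 2)) + p powr (c / 2) / s"
    unfolding a(1) s(2) using s(1) r(1) by (simp add: field_simps)
  finally show ?thesis unfolding a(2) by (simp add: s_def p_def)
qed

lemma ceiling_powr_bounds:
  assumes "1 \<le> P" "0 \<le> r"
  defines "H \<equiv> nat \<lceil>real P powr r\<rceil>"
  shows "0 < H" "real P powr r \<le> real H" "real H \<le> 2 * real P powr r"
proof -
  have "1 \<le> real P powr r" using assms by (simp add: ge_one_powr_ge_zero)
  then show "0 < H" "real P powr r \<le> real H" "real H \<le> 2 * real P powr r"
    unfolding H_def by linarith+
qed

text \<open>
  The index \<open>n = 0\<close> has frequency \<open>0\<close> and so adds to the constant coefficient. It is harmless: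
  its argument \<open>-1/2\<close> is where the kernel is smallest in order of magnitude.
\<close>
lemma fejer_weight_zero_le:
  assumes "0 < c" "1 \<le> P" "0 < H"
  shows "fejer_weight c P H 0 \<le> 1"
proof -
  have "fejer H (- (1 / 2)) * (- (1 / 2))\<^sup>2 \<le> 1 / (4 * real H)"
    using assms by (intro fejer_concentration) auto
  then have "fejer H (- (1 / 2)) \<le> 1 / real H" by (simp add: power2_eq_square field_simps)
  also have "\<dots> \<le> 1" using assms by simp
  finally show ?thesis using assms by (simp add: fejer_weight_def weight_def gap_def)
qed

text \<open>
  At integer frequencies a cosine sum is even and 1-periodic.
\<close>
lemma fold_frequency:
  obtains \<xi>' where "0 \<le> \<xi>'" "\<xi>' \<le> 1 / 2" "\<And>s::int. cos (2 * pi * of_int s * \<xi>) = cos (2 * pi * of_int s * \<xi>')"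
proof -
  define m where "m = round \<xi>"
  have "\<bar>\<xi> - of_int m\<bar> \<le> 1 / 2"
    using of_int_round_abs_le[of \<xi>] by (simp add: m_def abs_minus_commute)
  moreover have "cos (2 * pi * of_int s * \<xi>) = cos (2 * pi * of_int s * \<bar>\<xi> - of_int m\<bar>)" for s :: int
  proof -
    have "2 * pi * of_int s * \<xi> = 2 * pi * of_int s * (\<xi> - of_int m) + 2 * pi * of_int (s * m)"
      by (simp add: algebra_simps)
    then have "cos (2 * pi * of_int s * \<xi>) = cos (2 * pi * of_int s * (\<xi> - of_int m))"
      by (simp only: cos_add cos_int_2pin sin_int_2pin mult_1_right mult_zero_right diff_zero)
    also have "\<dots> = cos (2 * pi * of_int s * \<bar>\<xi> - of_int m\<bar>)"
    proof -
      have "cos (x * \<bar>d\<bar>) = cos (x * d)" for x d :: real by (simp add: abs_if)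
      then show ?thesis by simp
    qed
    finally show ?thesis .
  qed
  ultimately show ?thesis by (rule that[OF abs_ge_zero])
qed

text \<open>
  The two estimates for the frequency \<open>\<xi>\<close> are exchanged at \<open>\<xi> = P\<close> to the power \<open>-1/5\<close>. Below this
  point the Riemann sum error, of order \<open>\<xi>\<close> times \<open>P\<close> to the power \<open>2 c - 1\<close>, is at most of the
  allowed order \<open>P\<close> to the power \<open>2 c - 6/5 = c - \<eta>\<close>, and the rotation by \<open>e (- \<xi> / 2)\<close>, which
  is close to 1, costs no more. Above it the second difference test suffices.
\<close>
lemma Re_halfsum_lower:
  assumes c: "1 < c" "c < 6 / 5" and P: "1 \<le> P" and \<xi>: "0 \<le> \<xi>" "\<xi> \<le> 1 / 2"
  defines "K \<equiv> 224 / sqrt (c * (c - 1) / 2)"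
  shows "- ((2 * K + 9 * pi + 4) * real P powr (2 * c - 6 / 5)) \<le> Re (halfsum c P \<xi>)"
proof -
  define p where "p = real P"
  have p: "1 \<le> p" using P by (simp add: p_def)
  let ?E = "p powr (2 * c - 6 / 5)"
  have K: "0 \<le> K" using c by (simp add: K_def)
  have c2: "c < 2" using c by simp
  have pE: "p powr t \<le> ?E" if "t \<le> 2 * c - 6 / 5" for t using that p by (rule powr_mono)
  show ?thesis
  proof (cases "p powr (- 1 / 5) \<le> \<xi>")
    case True
    have "0 < p powr (- 1 / 5)" using p by simp
    then have \<xi>0: "0 < \<xi>" using True by linarith
    have "\<xi> * p powr (c - 2) \<le> 1 * 1"
      using \<xi> p c powr_mono[of "c - 2" 0 p] by (intro mult_mono) auto
    then have "cmod (expsum c P \<xi>) \<le> K * (sqrt \<xi> * p powr (3 * c / 2 - 1) + p powr (c / 2) / sqrt \<xi>)"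
      using expsum_le_two_terms[OF c(1) c2 P, of \<xi>] \<xi>0 by (simp add: K_def p_def)
    also have "\<dots> \<le> K * (?E + ?E)"
    proof (intro mult_left_mono add_mono K)
      have "sqrt \<xi> \<le> 1" using \<xi> by simp
      then have "sqrt \<xi> * p powr (3 * c / 2 - 1) \<le> 1 * p powr (3 * c / 2 - 1)"
        by (intro mult_right_mono) auto
      also have "\<dots> \<le> ?E" using c by (simp add: pE)
      finally show "sqrt \<xi> * p powr (3 * c / 2 - 1) \<le> ?E" .
      have "p powr (- 1 / 10) = sqrt (p powr (- 1 / 5))"
        using p by (simp add: powr_half_sqrt[symmetric] powr_powr)
      also have "\<dots> \<le> sqrt \<xi>" using True by simp
      finally have "p powr (c / 2) / sqrt \<xi> \<le> p powr (c / 2) / p powr (- 1 / 10)"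
        using p by (intro divide_left_mono mult_pos_pos) (auto simp: \<xi>0)
      also have "\<dots> = p powr (c / 2 + 1 / 10)" using p by (simp add: powr_diff[symmetric])
      also have "\<dots> \<le> ?E" using c by (intro pE) simp
      finally show "p powr (c / 2) / sqrt \<xi> \<le> ?E" .
    qed
    finally have "cmod (halfsum c P \<xi>) \<le> 2 * K * ?E" by (simp add: halfsum_eq norm_mult)
    moreover have "0 \<le> (9 * pi + 4) * ?E" by simp
    moreover have "(2 * K + 9 * pi + 4) * ?E = 2 * K * ?E + (9 * pi + 4) * ?E"
      by (simp add: algebra_simps)
    ultimately have "- ((2 * K + 9 * pi + 4) * ?E) \<le> - cmod (halfsum c P \<xi>)"
      by linarith
    then show ?thesis using abs_Re_le_cmod[of "halfsum c P \<xi>"] by (simp add: p_def)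
  next
    case False
    let ?S = "expsum c P \<xi>"
    have "\<xi> * p powr c \<le> p powr (- 1 / 5) * p powr c"
      using False by (intro mult_right_mono) auto
    also have "\<dots> = p powr (c - 1 / 5)" by (simp add: powr_add[symmetric])
    finally have \<xi>p: "\<xi> * p powr c \<le> p powr (c - 1 / 5)" .
    have low: "- 4 * p powr (c - 1) * (1 + 2 * pi * \<xi> * p powr c) \<le> Re ?S"
    proof (cases "\<xi> = 0")
      case True
      have "- 4 * p powr (c - 1) \<le> Re (expsum c P 0)"
        using Re_expsum_zero[OF c(1) c2 P] powr_ge_zero[of p c] unfolding p_def by linarith
      then show ?thesis unfolding True by simp
    next
      case False
      then show ?thesis using Re_expsum_small_frequency[OF c(1) c2 P, of \<xi>] \<xi> by (simp add: p_def)
    qed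
    have "p powr (c - 1) * (\<xi> * p powr c) \<le> p powr (c - 1) * p powr (c - 1 / 5)"
      using \<xi>p by (intro mult_left_mono) auto
    also have "\<dots> = ?E" by (simp add: powr_add[symmetric])
    finally have "p powr (c - 1) * (\<xi> * p powr c) \<le> ?E" .
    then have "8 * pi * (p powr (c - 1) * (\<xi> * p powr c)) \<le> 8 * pi * ?E"
      by (intro mult_left_mono) auto
    moreover have "p powr (c - 1) \<le> ?E" using c by (intro pE) simp
    moreover have "- 4 * p powr (c - 1) * (1 + 2 * pi * \<xi> * p powr c)
        = - (4 * p powr (c - 1)) - 8 * pi * (p powr (c - 1) * (\<xi> * p powr c))"
      by (simp add: algebra_simps)
    moreover have "(8 * pi + 4) * ?E = 8 * pi * ?E + 4 * ?E" by (simp add: algebra_simps)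
    ultimately have S: "- ((8 * pi + 4) * ?E) \<le> Re ?S"
      using low by linarith
    have "cmod (1 - e (- \<xi> / 2)) \<le> 2 * \<bar>pi * (- \<xi> / 2)\<bar>"
      unfolding e_minus_one by (intro mult_left_mono abs_sin_x_le_abs_x) auto
    also have "\<dots> = pi * \<xi>" using \<xi> by (simp add: abs_mult)
    finally have rot: "cmod (1 - e (- \<xi> / 2)) \<le> pi * \<xi>" .
    have "cmod (?S - halfsum c P \<xi>) = cmod (1 - e (- \<xi> / 2)) * cmod ?S"
      unfolding halfsum_eq norm_mult[symmetric] by (simp add: left_diff_distrib)
    also have "\<dots> \<le> pi * \<xi> * p powr c"
      using rot norm_expsum_le[OF c(1), of P \<xi>] \<xi> by (intro mult_mono) (auto simp: p_def)
    also have "\<dots> = pi * (\<xi> * p powr c)" by simp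
    also have "\<dots> \<le> pi * p powr (c - 1 / 5)" using \<xi>p by (intro mult_left_mono) auto
    also have "\<dots> \<le> pi * ?E" using c by (intro mult_left_mono pE) auto
    finally have "Re ?S - Re (halfsum c P \<xi>) \<le> pi * ?E"
      using abs_Re_le_cmod[of "?S - halfsum c P \<xi>"] unfolding minus_complex.sel by linarith
    moreover have "0 \<le> 2 * K * ?E" using K by simp
    ultimately show ?thesis using S unfolding p_def[symmetric] by (simp add: algebra_simps)
  qed
qed

text \<open>
  All error terms are measured against \<open>X\<close>, which is \<open>P\<close> to the power
  \<open>2 c - 6/5 = c - \<eta>\<close>: the frequencies away from \<open>0\<close> contribute \<open>H * B\<close>, the frequency \<open>\<xi>\<close>
  contributes \<open>2 * (2 * K + 9 * pi + 4) * X\<close>, and the removal of the floor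
  \<open>2 * pi\<^sup>2 * P\<^sup>c / H\<close>. The constant \<open>M\<close> is generous enough for their sum, and also for the
  mass to stay above \<open>P\<^sup>c / 2\<close> after \<open>M * X\<close> is added.
\<close>
lemma gamma_S_floor_powers_le_of_powr:
  assumes c: "1 < c" "c < 6 / 5" and P: "4 \<le> P" and PN: "real P powr c \<le> real N"
  defines "K \<equiv> 224 / sqrt (c * (c - 1) / 2)"
  defines "M \<equiv> 100 * K + 100 * pi\<^sup>2 + 100"
  shows "gamma_S (floor_powers c) N \<le> 2 * (1 + M) * real P powr (- (6 / 5 - c))"
proof -
  define p where "p = real P"
  have p: "4 \<le> p" using P by (simp add: p_def)
  have K: "0 \<le> K" using c by (simp add: K_def)
  define \<eta> where "\<eta> = 6 / 5 - c"
  have \<eta>: "0 < \<eta>" "\<eta> < 1 / 5" using c by (auto simp: \<eta>_def)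
  define H where "H = nat \<lceil>p powr \<eta>\<rceil>"
  have H: "0 < H" "p powr \<eta> \<le> real H" "real H \<le> 2 * p powr \<eta>"
    using ceiling_powr_bounds[of P \<eta>] P \<eta> by (auto simp: H_def p_def)
  define X where "X = p powr (2 * c - 6 / 5)"
  have pX: "p powr t \<le> X" if "t \<le> 2 * c - 6 / 5" for t
    unfolding X_def using that p by (intro powr_mono) auto
  define B where "B = 6 * K * p powr (3 * c / 2 - 1 + \<eta> / 2)"
  have B0: "0 \<le> B" using K by (simp add: B_def)
  have B: "cmod (expsum c P \<alpha>) \<le> B" if \<alpha>: "1 / 2 \<le> \<bar>\<alpha>\<bar>" "\<bar>\<alpha>\<bar> \<le> real H" for \<alpha>
  proof -
    \<comment> \<open>The second difference test asks for increments of at most 1; this is where \<open>4 \<le> P\<close> enters.\<close>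
    have "\<bar>\<alpha>\<bar> * p powr (c - 2) \<le> 2 * p powr \<eta> * p powr (c - 2)"
      using \<alpha> H by (intro mult_right_mono) auto
    also have "\<dots> = 2 * p powr (- 4 / 5)" by (simp add: powr_add[symmetric] \<eta>_def)
    also have "\<dots> \<le> 2 * p powr (- 1 / 2)" using p by (intro mult_left_mono powr_mono) auto
    also have "\<dots> \<le> 2 * 4 powr (- 1 / 2)" using p by (intro mult_left_mono powr_mono2') auto
    also have "\<dots> = 1" using powr_half_sqrt[of "4::real"] by (simp add: powr_minus)
    finally have small: "\<bar>\<alpha>\<bar> * p powr (c - 2) \<le> 1" .
    have nz: "\<alpha> \<noteq> 0" and sp: "0 < sqrt \<bar>\<alpha>\<bar>" using \<alpha> by auto
    have "cmod (expsum c P \<alpha>) \<le> K * (sqrt \<bar>\<alpha>\<bar> * p powr (3 * c / 2 - 1) + p powr (c / 2) / sqrt \<bar>\<alpha>\<bar>)"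
      using expsum_le_two_terms[OF c(1) _ _ nz, of P] small c P by (simp add: K_def p_def)
    also have "\<dots> \<le> K * (sqrt \<bar>\<alpha>\<bar> * p powr (3 * c / 2 - 1) + 2 * (sqrt \<bar>\<alpha>\<bar> * p powr (3 * c / 2 - 1)))"
    proof (intro mult_left_mono add_left_mono K)
      have "p powr (c / 2) / sqrt \<bar>\<alpha>\<bar> \<le> p powr (3 * c / 2 - 1) * (2 * sqrt \<bar>\<alpha>\<bar>)"
      proof -
        have "1 \<le> 2 * (sqrt \<bar>\<alpha>\<bar> * sqrt \<bar>\<alpha>\<bar>)" using \<alpha> by simp
        then have "1 / sqrt \<bar>\<alpha>\<bar> \<le> 2 * sqrt \<bar>\<alpha>\<bar>"
          using sp by (simp add: divide_le_eq mult.assoc del: real_sqrt_mult_self real_sqrt_abs2)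
        then have "p powr (c / 2) * (1 / sqrt \<bar>\<alpha>\<bar>) \<le> p powr (3 * c / 2 - 1) * (2 * sqrt \<bar>\<alpha>\<bar>)"
          using p c sp by (intro mult_mono powr_mono) auto
        then show ?thesis by simp
      qed
      then show "p powr (c / 2) / sqrt \<bar>\<alpha>\<bar> \<le> 2 * (sqrt \<bar>\<alpha>\<bar> * p powr (3 * c / 2 - 1))" by (simp add: mult_ac)
    qed
    also have "\<dots> = 3 * K * p powr (3 * c / 2 - 1) * sqrt \<bar>\<alpha>\<bar>" by (simp add: algebra_simps)
    also have "\<dots> \<le> 3 * K * p powr (3 * c / 2 - 1) * (2 * p powr (\<eta> / 2))"
    proof (intro mult_left_mono)
      have "\<bar>\<alpha>\<bar> \<le> (2 * p powr (\<eta> / 2))\<^sup>2"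
        using \<alpha> H by (simp add: power_mult_distrib power2_eq_square flip: powr_add)
      then show "sqrt \<bar>\<alpha>\<bar> \<le> 2 * p powr (\<eta> / 2)" by (intro real_le_lsqrt) auto
    qed (use K in auto)
    also have "\<dots> = B" by (simp add: B_def powr_add)
    finally show ?thesis .
  qed
  have HB: "H * B \<le> 12 * K * X"
  proof -
    have "H * B \<le> 2 * p powr \<eta> * B" using H B0 by (intro mult_right_mono) auto
    also have "\<dots> = 12 * K * (p powr (3 * c / 2 - 1 + \<eta> / 2) * p powr \<eta>)" by (simp add: B_def)
    also have "\<dots> = 12 * K * p powr (3 * c / 2 - 1 + \<eta> / 2 + \<eta>)" by (simp only: powr_add[symmetric])
    also have "\<dots> \<le> 12 * K * X"
    proof (intro mult_left_mono pX)
      show "3 * c / 2 - 1 + \<eta> / 2 + \<eta> \<le> 2 * c - 6 / 5" using c by (simp add: \<eta>_def diff_divide_distrib)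
    qed (use K in auto)
    finally show ?thesis .
  qed
  have PH: "2 * pi\<^sup>2 * p powr c / real H \<le> 2 * pi\<^sup>2 * X"
  proof -
    have "p powr c / real H \<le> p powr c / p powr \<eta>" using H p by (intro divide_left_mono) auto
    also have "\<dots> = X" by (simp add: X_def \<eta>_def powr_diff[symmetric])
    finally have "2 * pi\<^sup>2 * (p powr c / real H) \<le> 2 * pi\<^sup>2 * X" by (intro mult_left_mono) auto
    then show ?thesis by simp
  qed
  let ?D = "(2 * K + 9 * pi + 4) * X"
  let ?f = "\<lambda>n. \<lfloor>real n powr c\<rfloor>"
  have X1: "1 \<le> X" using p c by (simp add: X_def ge_one_powr_ge_zero)
  have pi: "pi \<le> pi\<^sup>2" using pi_gt3 by (simp add: power2_eq_square)
  have lower: "- (M * X) \<le> (\<Sum>n<P. fejer_weight c P H n * cos (2 * pi * of_int (?f n) * \<xi>))" for \<xi>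
  proof -
    obtain \<xi>' where \<xi>': "0 \<le> \<xi>'" "\<xi>' \<le> 1 / 2"
      and eq: "\<And>s::int. cos (2 * pi * of_int s * \<xi>) = cos (2 * pi * of_int s * \<xi>')"
      using fold_frequency[of \<xi>] by blast
    have "- (H * B + 2 * ?D + 2 * pi\<^sup>2 * real P powr c / real H)
        \<le> (\<Sum>n<P. fejer_weight c P H n * cos (2 * pi * of_int (?f n) * \<xi>'))"
    proof (rule fejer_weight_sum_lower[OF c(1) \<xi>' H(1) B0 B])
      show "0 \<le> ?D" using K X1 by simp
      show "- ?D \<le> Re (halfsum c P \<xi>')"
        using Re_halfsum_lower[OF c _ \<xi>', of P] P by (simp add: K_def X_def p_def)
    qed
    moreover have "H * B + 2 * ?D + 2 * pi\<^sup>2 * p powr c / real H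
        \<le> (12 * K + 2 * (2 * K + 9 * pi + 4) + 2 * pi\<^sup>2) * X"
      using HB PH by (simp add: algebra_simps)
    moreover have "\<dots> \<le> M * X"
    proof (rule mult_right_mono)
      show "12 * K + 2 * (2 * K + 9 * pi + 4) + 2 * pi\<^sup>2 \<le> M"
        unfolding M_def using K pi pi_ge_zero by argo
    qed (use X1 in simp)
    ultimately show ?thesis unfolding eq p_def by linarith
  qed
  have mass: "p powr c / 2 \<le> (\<Sum>n<P. fejer_weight c P H n) + M * X"
  proof -
    have "p powr (c - 1) \<le> X" using c by (intro pX) simp
    then have "4 * p powr (c - 1) + H * B \<le> (4 + 12 * K) * X" using HB by (simp add: algebra_simps)
    also have "\<dots> \<le> M * X" using K X1 by (intro mult_right_mono) (auto simp: M_def)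
    finally show ?thesis
      using fejer_weight_mass_lower[OF c(1) H(1) B0 B] Re_expsum_zero[OF c(1) _, of P] c P
      by (simp add: p_def)
  qed
  have range: "?f ` {..<P} \<subseteq> insert 0 (floor_powers c \<inter> {1..int N})"
  proof (intro image_subsetI)
    fix n assume n: "n \<in> {..<P}"
    show "?f n \<in> insert 0 (floor_powers c \<inter> {1..int N})"
    proof (cases "n = 0")
      case False
      have "1 \<le> real n powr c" using False c by (simp add: ge_one_powr_ge_zero)
      moreover have "real n powr c \<le> real P powr c" using n c by (intro powr_mono2) auto
      ultimately have "1 \<le> ?f n" "?f n \<le> int N" using PN by linarith+
      then show ?thesis using False by (auto simp: floor_powers_def)
    qed simp
  qed
  have zero: "{n \<in> {..<P}. ?f n = 0} = {0}"
  proof -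
    have "1 \<le> real n powr c" if "n \<noteq> 0" for n
      using that c by (simp add: ge_one_powr_ge_zero)
    then have "?f n \<noteq> 0" if "n \<noteq> 0" for n using that by (metis floor_less_one linorder_not_less zero_less_one)
    then show ?thesis using P by auto
  qed
  have pc: "0 < p powr c" using p by simp
  have N: "1 \<le> N" using PN pc unfolding p_def[symmetric] by (cases N) auto
  have "gamma_S (floor_powers c) N
      \<le> ((\<Sum>n\<in>{n \<in> {..<P}. ?f n = 0}. fejer_weight c P H n) + M * X) / ((\<Sum>n<P. fejer_weight c P H n) + M * X)"
  proof (rule gamma_S_le[OF N _ range lower])
    show "0 < (\<Sum>n<P. fejer_weight c P H n) + M * X" using mass pc by linarith
  qed simp
  also have "\<dots> \<le> ((1 + M) * X) / (p powr c / 2)"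
  proof (rule frac_le)
    have "fejer_weight c P H 0 \<le> 1" using fejer_weight_zero_le[of c P H] c P H by auto
    then show "(\<Sum>n\<in>{n \<in> {..<P}. ?f n = 0}. fejer_weight c P H n) + M * X \<le> (1 + M) * X"
      unfolding zero using X1 by (simp add: algebra_simps)
    show "0 \<le> (1 + M) * X" using X1 K by (simp add: M_def)
    show "p powr c / 2 \<le> (\<Sum>n<P. fejer_weight c P H n) + M * X" by (rule mass)
  qed (use pc in simp)
  also have "\<dots> = 2 * (1 + M) * (X / p powr c)" by simp
  also have "X / p powr c = p powr (- (6 / 5 - c))" by (simp add: X_def powr_diff[symmetric])
  finally show ?thesis by (simp add: p_def)
qed

lemma gamma_S_le_one:
  assumes "1 \<le> N"
  shows "gamma_S S N \<le> 1"
  using gamma_S_le[OF assms, of "{}::nat set" "\<lambda>_. 0" S 1 "\<lambda>_. 0"] by simp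

text \<open>
  The largest admissible \<open>P\<close> is at least half of \<open>N\<close> to the power \<open>1 / c\<close>. Small \<open>N\<close> are covered by
  the trivial bound \<open>1\<close>.
\<close>
theorem gamma_S_floor_powers_le:
  assumes c: "1 < c" "c < 6 / 5"
  obtains C where "0 < C" "\<And>N. 1 \<le> N \<Longrightarrow> gamma_S (floor_powers c) N \<le> C * real N powr (- (6 / (5 * c) - 1))"
proof -
  define M where "M = 100 * (224 / sqrt (c * (c - 1) / 2)) + 100 * pi\<^sup>2 + 100"
  have M: "0 < M" unfolding M_def using c by (intro add_nonneg_pos add_nonneg_nonneg) auto
  have ex: "1 / c * (- (6 / 5 - c)) = - (6 / (5 * c) - 1)" using c by (simp add: field_simps)
  have bound: "gamma_S (floor_powers c) N \<le> (4 * (1 + M)) * real N powr (- (6 / (5 * c) - 1))" if N: "1 \<le> N" for N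
  proof -
    define x where "x = real N powr (1 / c)"
    have xc: "x powr c = real N" using c N by (simp add: x_def powr_powr)
    have xe: "x powr (- (6 / 5 - c)) = real N powr (- (6 / (5 * c) - 1))"
      unfolding x_def powr_powr ex ..
    have x1: "1 \<le> x" using N c by (simp add: x_def ge_one_powr_ge_zero)
    show ?thesis
    proof (cases "4 \<le> x")
      case True
      define P where "P = nat \<lfloor>x\<rfloor>"
      have P: "4 \<le> P" "real P \<le> x" "x \<le> 2 * real P" using True unfolding P_def by linarith+
      have "real P powr c \<le> x powr c" using P c by (intro powr_mono2) auto
      then have "gamma_S (floor_powers c) N \<le> 2 * (1 + M) * real P powr (- (6 / 5 - c))"
        unfolding xc M_def using c P by (intro gamma_S_floor_powers_le_of_powr) auto
      also have "\<dots> \<le> 2 * (1 + M) * (2 * x powr (- (6 / 5 - c)))"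
      proof (rule mult_left_mono)
        have "real P powr (- (6 / 5 - c)) \<le> (x / 2) powr (- (6 / 5 - c))"
          using P True c by (intro powr_mono2') auto
        also have "\<dots> = 2 powr (6 / 5 - c) * x powr (- (6 / 5 - c))"
          using x1 by (simp add: powr_divide powr_minus powr_diff field_simps)
        also have "\<dots> \<le> 2 powr 1 * x powr (- (6 / 5 - c))"
          using c by (intro mult_right_mono powr_mono) auto
        finally show "real P powr (- (6 / 5 - c)) \<le> 2 * x powr (- (6 / 5 - c))" by simp
      qed (use M in simp)
      finally show ?thesis unfolding xe by (simp add: algebra_simps)
    next
      case False
      have "gamma_S (floor_powers c) N \<le> 1" by (rule gamma_S_le_one[OF N])
      also have "1 \<le> 4 * x powr (- 1)"
        using False x1 by (simp add: powr_minus powr_one field_simps)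
      also have "\<dots> \<le> 4 * x powr (- (6 / 5 - c))" using c x1 by (intro mult_left_mono powr_mono) auto
      also have "4 * x powr (- (6 / 5 - c)) \<le> (4 * (1 + M)) * x powr (- (6 / 5 - c))"
        using M by (intro mult_right_mono) auto
      finally show ?thesis unfolding xe by simp
    qed
  qed
  show ?thesis using bound M by (intro that[of "4 * (1 + M)"]) auto
qed

theorem theorem1p3:
  fixes c :: real
  assumes "1 < c" and "c < 6 / 5"
  shows "(\<forall>\<epsilon>::real. \<epsilon> > 0 \<longrightarrow>
            (\<exists>C>0. \<forall>N::nat. N \<ge> 1 \<longrightarrow>
               \<bar>gamma_S (floor_powers c) N\<bar> \<le> C * real N powr (- (6 / (5 * c) - 1) + \<epsilon>)))
       \<and> (\<exists>C::real. C > 0 \<and> (\<forall>N::nat. N \<ge> 1 \<longrightarrow> (\<forall>A::int set.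
            A \<subseteq> {1..int N} \<and>
            \<not> (\<exists>x::int. \<exists>n::nat. n \<ge> 1 \<and> x \<in> A \<and> x + \<lfloor>real n powr c\<rfloor> \<in> A) \<longrightarrow>
            real (card A) \<le> C * real N powr (1 - (6 / (5 * c) - 1)))))"
proof -
  obtain C where C: "0 < C"
    "\<And>N. 1 \<le> N \<Longrightarrow> gamma_S (floor_powers c) N \<le> C * real N powr (- (6 / (5 * c) - 1))"
    using gamma_S_floor_powers_le[OF assms] by blast
  show ?thesis
  proof (intro conjI allI impI)
    fix \<epsilon> :: real assume \<epsilon>: "\<epsilon> > 0"
    show "\<exists>C>0. \<forall>N::nat. N \<ge> 1 \<longrightarrow>
        \<bar>gamma_S (floor_powers c) N\<bar> \<le> C * real N powr (- (6 / (5 * c) - 1) + \<epsilon>)"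
    proof (intro exI[of _ C] conjI allI impI C(1))
      fix N :: nat assume N: "N \<ge> 1"
      have "\<bar>gamma_S (floor_powers c) N\<bar> \<le> C * real N powr (- (6 / (5 * c) - 1))"
        using C(2)[OF N] gamma_S_nonneg[OF N] by simp
      also have "\<dots> \<le> C * real N powr (- (6 / (5 * c) - 1) + \<epsilon>)"
        using C(1) N \<epsilon> by (intro mult_left_mono powr_mono) auto
      finally show "\<bar>gamma_S (floor_powers c) N\<bar> \<le> C * real N powr (- (6 / (5 * c) - 1) + \<epsilon>)" .
    qed
  next
    show "\<exists>C::real. C > 0 \<and> (\<forall>N::nat. N \<ge> 1 \<longrightarrow> (\<forall>A::int set.
        A \<subseteq> {1..int N} \<and>
        \<not> (\<exists>x::int. \<exists>n::nat. n \<ge> 1 \<and> x \<in> A \<and> x + \<lfloor>real n powr c\<rfloor> \<in> A) \<longrightarrow>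
        real (card A) \<le> C * real N powr (1 - (6 / (5 * c) - 1))))"
    proof (intro exI[of _ "2 * C"] conjI allI impI)
      fix N :: nat and A :: "int set"
      assume N: "N \<ge> 1" and A: "A \<subseteq> {1..int N} \<and>
        \<not> (\<exists>x::int. \<exists>n::nat. n \<ge> 1 \<and> x \<in> A \<and> x + \<lfloor>real n powr c\<rfloor> \<in> A)"
      have "real (card A) \<le> 2 * real N * gamma_S (floor_powers c) N"
        using N A by (intro card_le_gamma_S) (auto simp: floor_powers_def)
      also have "\<dots> \<le> 2 * real N * (C * real N powr (- (6 / (5 * c) - 1)))"
        using C(2)[OF N] by (intro mult_left_mono) auto
      also have "\<dots> = 2 * C * (real N powr 1 * real N powr (- (6 / (5 * c) - 1)))" by simp
      also have "real N powr 1 * real N powr (- (6 / (5 * c) - 1)) = real N powr (1 - (6 / (5 * c) - 1))"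
        by (simp only: powr_add[symmetric]) simp
      finally show "real (card A) \<le> 2 * C * real N powr (1 - (6 / (5 * c) - 1))" .
    qed (use C(1) in simp)
  qed
qed

end
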